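(* Let $T$ be a linear operator in $H$ with domain $\operatorname{dom}(T)$ (not necessarily closed, closable or densely defined). Let $\mathcal V$ be the set of all finite-dimensional subspaces $V\subset H$, and define \[ W_{e1}(T):=\bigcap_{V\in\mathcal V}\overline{W(T|_{V^{\perp}\cap\operatorname{dom}(T)})},\qquad W_{e2}(T):=\bigcap_{K\in L(H),\ \operatorname{rank}K<\infty}\overline{W(T+K)}, \] \[ W_{e3}(T):=\bigcap_{K\in L(H),\ K\text{ compact}}\overline{W(T+K)}, \] \[ W_{e4}(T):=\{\lambda\in\mathbb C:\ \exists\,(e_n)_{n\in\mathbb N}\subset\operatorname{dom}(T)\text{ orthonormal with }\langle Te_n,e_n\rangle\to\lambda\}. \] Then in general \[ W_{e1}(T)\subset W_{e4}(T)\subset W_{e2}(T)=W_{e3}(T)=W_e(T). \] If $\overline{\operatorname{dom}(T)}=H$, then \[ W_{e1}(T)\subset W_{e4}(T)=W_{e2}(T)=W_{e3}(T)=W_e(T). \] If $\overline{\operatorname{dom}(T)\cap\operatorname{dom}(T^* )}=H$ or if $W(T)\neq\mathbb C$, then $W_{ei}(T)=W_e(T)$ for $i=1,2,3,4$.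
   Context: $H$ is a separable infinite-dimensional complex Hilbert space with inner product $\langle\cdot,\cdot\rangle$ and norm $\|\cdot\|$; $x_n\stackrel{w}{\to}x$ denotes weak convergence; $L(H)$ is the space of bounded linear operators on $H$. For a linear operator $T$ with domain $\operatorname{dom}(T)\subset H$, the numerical range is $W(T)=\{\langle Tx,x\rangle: x\in\operatorname{dom}(T),\ \|x\|=1\}$, and the essential numerical range is $W_e(T)=\{\lambda\in\mathbb C:\exists\,(x_n)_{n\in\mathbb N}\subset\operatorname{dom}(T)\text{ with }\|x_n\|=1,\ x_n\stackrel{w}{\to}0,\ \langle Tx_n,x_n\rangle\to\lambda\}$. For a subspace $M\subset\operatorname{dom}(T)$, $T|_M$ denotes the restriction of $T$ to $M$ (so $W(T|_M)=\{\langle Tx,x\rangle:x\in M,\|x\|=1\}$). $T^*$ is the Hilbert space adjoint (defined when $T$ is densely defined); $T+K$ has domain $\operatorname{dom}(T)$. *)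

theory Defs
  imports "HOL-Analysis.Analysis"
begin

class complex_vector = real_vector +
  fixes scaleC :: "complex \<Rightarrow> 'a \<Rightarrow> 'a" (infixr \<open>*\<^sub>C\<close> 75)
  assumes scaleR_scaleC: "scaleR r = scaleC (complex_of_real r)"
    and scaleC_add_right: "a *\<^sub>C (x + y) = a *\<^sub>C x + a *\<^sub>C y"
    and scaleC_add_left: "(a + b) *\<^sub>C x = a *\<^sub>C x + b *\<^sub>C x"
    and scaleC_scaleC: "a *\<^sub>C (b *\<^sub>C x) = (a * b) *\<^sub>C x"
    and scaleC_one: "1 *\<^sub>C x = x"

class complex_inner = complex_vector + real_normed_vector +
  fixes cinner :: "'a \<Rightarrow> 'a \<Rightarrow> complex"
  assumes cinner_commute: "cinner x y = cnj (cinner y x)"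
    and cinner_add_left: "cinner (x + y) z = cinner x z + cinner y z"
    and cinner_scaleC_left: "cinner (c *\<^sub>C x) y = c * cinner x y"
    and cinner_self_real_nonneg: "Im (cinner x x) = 0 \<and> Re (cinner x x) \<ge> 0"
    and cinner_eq_zero_iff: "cinner x x = 0 \<longleftrightarrow> x = 0"
    and norm_eq_sqrt_cinner: "norm x = sqrt (Re (cinner x x))"

class chilbert_space = complex_inner + complete_space

definition csubspace :: "'a::complex_vector set \<Rightarrow> bool" where
  "csubspace S \<longleftrightarrow> 0 \<in> S \<and> (\<forall>x\<in>S. \<forall>y\<in>S. x + y \<in> S) \<and> (\<forall>c. \<forall>x\<in>S. c *\<^sub>C x \<in> S)"

definition cspan :: "'a::complex_vector set \<Rightarrow> 'a set" where
  "cspan F = \<Inter>{S. csubspace S \<and> F \<subseteq> S}"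

definition finite_dim_csubspace :: "'a::complex_vector set \<Rightarrow> bool" where
  "finite_dim_csubspace V \<longleftrightarrow> csubspace V \<and> (\<exists>F. finite F \<and> V = cspan F)"

definition clinear_on :: "'a::complex_vector set \<Rightarrow> ('a \<Rightarrow> 'a) \<Rightarrow> bool" where
  "clinear_on D T \<longleftrightarrow> csubspace D \<and>
     (\<forall>x\<in>D. \<forall>y\<in>D. T (x + y) = T x + T y) \<and> (\<forall>c. \<forall>x\<in>D. T (c *\<^sub>C x) = c *\<^sub>C T x)"

definition cbounded_linear :: "('a::complex_inner \<Rightarrow> 'a) \<Rightarrow> bool" where
  "cbounded_linear K \<longleftrightarrow> clinear_on UNIV K \<and> (\<exists>C. \<forall>x. norm (K x) \<le> C * norm x)"

definition finite_rank :: "('a::complex_inner \<Rightarrow> 'a) \<Rightarrow> bool" where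
  "finite_rank K \<longleftrightarrow> (\<exists>F. finite F \<and> range K \<subseteq> cspan F)"

definition compact_op :: "('a::complex_inner \<Rightarrow> 'a) \<Rightarrow> bool" where
  "compact_op K \<longleftrightarrow> compact (closure (K ` cball 0 1))"

definition orth_compl :: "'a::complex_inner set \<Rightarrow> 'a set" where
  "orth_compl V = {x. \<forall>v\<in>V. cinner x v = 0}"

definition weak_conv :: "(nat \<Rightarrow> 'a::complex_inner) \<Rightarrow> 'a \<Rightarrow> bool" where
  "weak_conv x l \<longleftrightarrow> (\<forall>y. (\<lambda>n. cinner (x n) y) \<longlonglongrightarrow> cinner l y)"

definition adj_dom :: "'a::complex_inner set \<Rightarrow> ('a \<Rightarrow> 'a) \<Rightarrow> 'a set" where
  "adj_dom D T = {y. \<exists>z. \<forall>x\<in>D. cinner (T x) y = cinner x z}"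

definition num_range :: "'a::complex_inner set \<Rightarrow> ('a \<Rightarrow> 'a) \<Rightarrow> complex set" where
  "num_range D T = {cinner (T x) x | x. x \<in> D \<and> norm x = 1}"

definition ess_num_range :: "'a::complex_inner set \<Rightarrow> ('a \<Rightarrow> 'a) \<Rightarrow> complex set" where
  "ess_num_range D T = {l. \<exists>x. (\<forall>n. x n \<in> D \<and> norm (x n) = 1) \<and> weak_conv x 0 \<and>
       (\<lambda>n. cinner (T (x n)) (x n)) \<longlonglongrightarrow> l}"

definition We1 :: "'a::complex_inner set \<Rightarrow> ('a \<Rightarrow> 'a) \<Rightarrow> complex set" where
  "We1 D T = \<Inter>{closure (num_range (orth_compl V \<inter> D) T) | V. finite_dim_csubspace V}"

definition We2 :: "'a::complex_inner set \<Rightarrow> ('a \<Rightarrow> 'a) \<Rightarrow> complex set" where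
  "We2 D T = \<Inter>{closure (num_range D (\<lambda>x. T x + K x)) | K. cbounded_linear K \<and> finite_rank K}"

definition We3 :: "'a::complex_inner set \<Rightarrow> ('a \<Rightarrow> 'a) \<Rightarrow> complex set" where
  "We3 D T = \<Inter>{closure (num_range D (\<lambda>x. T x + K x)) | K. cbounded_linear K \<and> compact_op K}"

definition We4 :: "'a::complex_inner set \<Rightarrow> ('a \<Rightarrow> 'a) \<Rightarrow> complex set" where
  "We4 D T = {l. \<exists>e. (\<forall>n. e n \<in> D) \<and>
       (\<forall>m n. cinner (e m) (e n) = (if m = n then 1 else 0)) \<and>
       (\<lambda>n. cinner (T (e n)) (e n)) \<longlonglongrightarrow> l}"

end

theory Submission
  imports Defs
begin

text \<open>
  The heart of the matter is what happens when \<open>0 \<notin> closure (W(T|V\<^sup>\<bottom> \<inter> D))\<close> for some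
  finite-dimensional \<open>V\<close>. By convexity \<open>Re (\<alpha> \<langle>Tx, x\<rangle>) \<ge> b \<parallel>x\<parallel>\<^sup>2\<close> on \<open>D\<^sub>0 = V\<^sup>\<bottom> \<inter> D\<close> for some
  \<open>\<alpha> \<noteq> 0\<close>, \<open>b > 0\<close>, and \<open>D\<^sub>0\<close> has a finite-dimensional complement in \<open>D\<close>, spanned by \<open>d\<^sub>1, \<dots>, d\<^sub>m\<close>.
  If all functionals \<open>y \<mapsto> \<langle>Ty, d\<^sub>j\<rangle>\<close> are bounded on \<open>D\<^sub>0\<close> with respect to the form norm, then adding a large
  multiple of a finite-rank operator to \<open>T\<close> keeps the numerical range of the sum away from 0. Otherwise
  there is a \<^emph>\<open>singular sequence\<close>: \<open>y\<^sub>n \<rightarrow> 0\<close> and \<open>\<langle>Ty\<^sub>n, y\<^sub>n\<rangle> \<rightarrow> 0\<close>, but \<open>\<langle>Ty\<^sub>n, w\<rangle> \<rightarrow> \<langle>v, w\<rangle>\<close> for all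
  \<open>w \<in> D\<close>, where \<open>\<langle>v, \<cdot>\<rangle>\<close> does not vanish on \<open>D\<close>. Since then \<open>\<langle>T(w + \<mu>y\<^sub>n), w + \<mu>y\<^sub>n\<rangle>\<close> tends to
  \<open>\<langle>Tw, w\<rangle> + \<mu>\<langle>v, w\<rangle>\<close>, every \<open>w\<close> with \<open>\<langle>v, w\<rangle> \<noteq> 0\<close> is a limit of vectors with any prescribed value
  of the quadratic form. This yields points of the essential numerical range, orthonormal sequences when
  \<open>D\<close> is dense, and \<open>W(T) = \<complex>\<close>; and it is impossible when \<open>dom T \<inter> dom T*\<close> is dense.
\<close>

subsection \<open>Complex inner products\<close>

lemma scaleC_zero_left [simp]: "0 *\<^sub>C (x::'a::complex_vector) = 0"
  using scaleC_add_left[of 0 0 x] by simp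

lemma scaleC_zero_right [simp]: "c *\<^sub>C (0::'a::complex_vector) = 0"
  using scaleC_add_right[of c 0 "0::'a"] by simp

lemma scaleC_minus_left [simp]: "(- c) *\<^sub>C (x::'a::complex_vector) = - (c *\<^sub>C x)"
  using scaleC_add_left[of c "- c" x] by (simp add: eq_neg_iff_add_eq_0 add.commute)

lemma scaleC_minus_right [simp]: "c *\<^sub>C (- x::'a::complex_vector) = - (c *\<^sub>C x)"
  using scaleC_add_right[of c x "- x"] by (simp add: eq_neg_iff_add_eq_0 add.commute)

lemma scaleC_diff_right: "c *\<^sub>C (x - y::'a::complex_vector) = c *\<^sub>C x - c *\<^sub>C y"
  using scaleC_add_right[of c x "- y"] by simp

lemma scaleC_one' [simp]: "1 *\<^sub>C (x::'a::complex_vector) = x"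
  by (rule scaleC_one)

lemma scaleC_sum_right: "c *\<^sub>C (\<Sum>i\<in>A. f i) = (\<Sum>i\<in>A. c *\<^sub>C (f i :: 'a::complex_vector))"
  by (induction A rule: infinite_finite_induct) (auto simp: scaleC_add_right)

lemma cinner_add_right: "cinner (x::'a::complex_inner) (y + z) = cinner x y + cinner x z"
  by (metis cinner_add_left cinner_commute complex_cnj_add)

lemma cinner_scaleC_right: "cinner (x::'a::complex_inner) (c *\<^sub>C y) = cnj c * cinner x y"
  by (metis cinner_scaleC_left cinner_commute complex_cnj_mult)

lemma cinner_zero_left [simp]: "cinner 0 (x::'a::complex_inner) = 0"
  using cinner_add_left[of 0 0 x] by simp

lemma cinner_zero_right [simp]: "cinner (x::'a::complex_inner) 0 = 0"
  using cinner_add_right[of x 0 0] by simp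

lemma cinner_minus_left [simp]: "cinner (- x) (y::'a::complex_inner) = - cinner x y"
  using cinner_add_left[of x "- x" y] by (simp add: eq_neg_iff_add_eq_0 add.commute)

lemma cinner_minus_right [simp]: "cinner x (- y::'a::complex_inner) = - cinner x y"
  using cinner_add_right[of x y "- y"] by (simp add: eq_neg_iff_add_eq_0 add.commute)

lemma cinner_diff_left: "cinner (x - y) (z::'a::complex_inner) = cinner x z - cinner y z"
  using cinner_add_left[of x "- y" z] by simp

lemma cinner_diff_right: "cinner (x::'a::complex_inner) (y - z) = cinner x y - cinner x z"
  using cinner_add_right[of x y "- z"] by simp

lemma cinner_sum_left: "cinner (\<Sum>i\<in>A. f i) (x::'a::complex_inner) = (\<Sum>i\<in>A. cinner (f i) x)"
  by (induction A rule: infinite_finite_induct) (auto simp: cinner_add_left)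

lemma cinner_sum_right: "cinner (x::'a::complex_inner) (\<Sum>i\<in>A. f i) = (\<Sum>i\<in>A. cinner x (f i))"
  by (induction A rule: infinite_finite_induct) (auto simp: cinner_add_right)

lemmas cinner_simps = cinner_add_left cinner_add_right cinner_diff_left cinner_diff_right
  cinner_scaleC_left cinner_scaleC_right

lemma cinner_self: "cinner x x = of_real ((norm (x::'a::complex_inner))\<^sup>2)"
  using cinner_self_real_nonneg[of x] by (simp add: norm_eq_sqrt_cinner complex_eq_iff)

lemma norm_scaleC: "norm (c *\<^sub>C (x::'a::complex_inner)) = cmod c * norm x"
proof -
  have "cinner (c *\<^sub>C x) (c *\<^sub>C x) = (c * cnj c) * cinner x x"
    by (simp add: cinner_simps)
  then have "of_real ((norm (c *\<^sub>C x))\<^sup>2) = (of_real ((cmod c * norm x)\<^sup>2) :: complex)"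
    by (simp only: cinner_self complex_norm_square[symmetric] power_mult_distrib of_real_mult)
  then have "(norm (c *\<^sub>C x))\<^sup>2 = (cmod c * norm x)\<^sup>2"
    by (simp only: of_real_eq_iff)
  then show ?thesis
    by (simp add: power2_eq_iff_nonneg)
qed

lemma norm_add_scaleC_sq:
  fixes x y :: "'a::complex_inner"
  shows "(norm (x + c *\<^sub>C y))\<^sup>2
    = (norm x)\<^sup>2 + 2 * Re (cnj c * cinner x y) + (cmod c)\<^sup>2 * (norm y)\<^sup>2"
proof -
  have "cinner (x + c *\<^sub>C y) (x + c *\<^sub>C y)
    = cinner x x + (cnj c * cinner x y + c * cinner y x) + (c * cnj c) * cinner y y"
    by (simp add: cinner_simps algebra_simps)
  also have "c * cinner y x = cnj (cnj c * cinner x y)"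
    using cinner_commute[of y x] by simp
  also have "(c * cnj c) * cinner y y = of_real ((cmod c)\<^sup>2 * (norm y)\<^sup>2)"
    by (simp only: complex_norm_square[symmetric] cinner_self of_real_mult)
  finally have "Re (cinner (x + c *\<^sub>C y) (x + c *\<^sub>C y))
    = Re (cinner x x) + 2 * Re (cnj c * cinner x y) + (cmod c)\<^sup>2 * (norm y)\<^sup>2"
    by (simp del: of_real_mult of_real_power)
  then show ?thesis
    by (simp only: cinner_self Re_complex_of_real)
qed

lemma cinner_cauchy_schwarz: "cmod (cinner x y) \<le> norm x * norm (y::'a::complex_inner)"
proof (cases "y = 0")
  case False
  define c where "c = - (cinner x y / of_real ((norm y)\<^sup>2))"
  have n: "norm y > 0" using False by simp
  have "cnj c * cinner x y = - of_real ((cmod (cinner x y))\<^sup>2 / (norm y)\<^sup>2)"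
    unfolding c_def by (simp add: complex_norm_square mult.commute del: of_real_power)
  then have r: "Re (cnj c * cinner x y) = - ((cmod (cinner x y))\<^sup>2 / (norm y)\<^sup>2)" by simp
  have m: "(cmod c)\<^sup>2 * (norm y)\<^sup>2 = (cmod (cinner x y))\<^sup>2 / (norm y)\<^sup>2"
    unfolding c_def using n by (simp add: norm_divide norm_mult power2_eq_square)
  have "0 \<le> (norm (x + c *\<^sub>C y))\<^sup>2" by simp
  then have "(cmod (cinner x y))\<^sup>2 / (norm y)\<^sup>2 \<le> (norm x)\<^sup>2"
    unfolding norm_add_scaleC_sq r m by simp
  then have "(cmod (cinner x y))\<^sup>2 \<le> (norm x * norm y)\<^sup>2"
    using n by (simp add: field_simps power_mult_distrib)
  then show ?thesis by (rule power2_le_imp_le) simp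
qed simp

lemma tendsto_cinner:
  fixes f g :: "'b \<Rightarrow> 'a::complex_inner"
  assumes "(f \<longlongrightarrow> a) F" "(g \<longlongrightarrow> b) F"
  shows "((\<lambda>x. cinner (f x) (g x)) \<longlongrightarrow> cinner a b) F"
proof -
  have "bounded_bilinear (cinner :: 'a \<Rightarrow> 'a \<Rightarrow> complex)"
  proof
    show "\<exists>K. \<forall>a b :: 'a. norm (cinner a b) \<le> norm a * norm b * K"
      by (rule exI[of _ 1]) (simp add: cinner_cauchy_schwarz)
  qed (simp_all add: cinner_simps scaleR_scaleC scaleR_conv_of_real)
  then show ?thesis using assms by (rule bounded_bilinear.tendsto)
qed

lemma tendsto_scaleC:
  fixes g :: "'b \<Rightarrow> 'a::complex_inner"
  assumes "(f \<longlongrightarrow> a) F" "(g \<longlongrightarrow> b) F"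
  shows "((\<lambda>x. f x *\<^sub>C g x) \<longlongrightarrow> a *\<^sub>C b) F"
proof -
  have "bounded_bilinear (scaleC :: complex \<Rightarrow> 'a \<Rightarrow> 'a)"
  proof
    show "\<exists>K. \<forall>a (b :: 'a). norm (a *\<^sub>C b) \<le> norm a * norm b * K"
      by (rule exI[of _ 1]) (simp add: norm_scaleC)
  qed (simp_all add: scaleC_add_left scaleC_add_right scaleR_scaleC scaleC_scaleC scaleR_conv_of_real mult.commute)
  then show ?thesis using assms by (rule bounded_bilinear.tendsto)
qed

section \<open>Complex subspaces, spans and linear maps on a domain\<close>

lemma csubspace_sum:
  assumes "csubspace S" "\<And>i. i \<in> A \<Longrightarrow> f i \<in> S"
  shows "(\<Sum>i\<in>A. f i) \<in> S"
  using assms(2) by (induction A rule: infinite_finite_induct) (use assms(1) in \<open>auto simp: csubspace_def\<close>)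

lemma csubspaceD:
  assumes "csubspace S"
  shows "0 \<in> S" "x \<in> S \<Longrightarrow> y \<in> S \<Longrightarrow> x + y \<in> S" "x \<in> S \<Longrightarrow> c *\<^sub>C x \<in> S"
    "x \<in> S \<Longrightarrow> y \<in> S \<Longrightarrow> x - y \<in> S"
proof -
  show "0 \<in> S" "x \<in> S \<Longrightarrow> y \<in> S \<Longrightarrow> x + y \<in> S" "x \<in> S \<Longrightarrow> c *\<^sub>C x \<in> S"
    using assms by (auto simp: csubspace_def)
  show "x - y \<in> S" if "x \<in> S" "y \<in> S"
  proof -
    have "x + (- 1) *\<^sub>C y \<in> S" using assms that unfolding csubspace_def by blast
    then show ?thesis by simp
  qed
qed

lemma csubspace_cspan: "csubspace (cspan F)"
  unfolding cspan_def csubspace_def by blast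

lemma cspan_superset: "F \<subseteq> cspan F"
  unfolding cspan_def by blast

lemma cspan_minimal: "csubspace S \<Longrightarrow> F \<subseteq> S \<Longrightarrow> cspan F \<subseteq> S"
  unfolding cspan_def by blast

lemma csubspace_orth_compl: "csubspace (orth_compl F)"
  unfolding csubspace_def orth_compl_def by (auto simp: cinner_simps)

lemma csubspace_Int: "csubspace A \<Longrightarrow> csubspace B \<Longrightarrow> csubspace (A \<inter> B)"
  unfolding csubspace_def by auto

lemma orth_compl_cspan: "orth_compl (cspan F) = orth_compl F"
proof
  show "orth_compl (cspan F) \<subseteq> orth_compl F"
    using cspan_superset unfolding orth_compl_def by blast
  show "orth_compl F \<subseteq> orth_compl (cspan F)"
  proof
    fix x assume x: "x \<in> orth_compl F"
    have "cspan F \<subseteq> {v. cinner x v = 0}"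
      by (rule cspan_minimal) (use x in \<open>auto simp: csubspace_def cinner_simps orth_compl_def\<close>)
    then show "x \<in> orth_compl (cspan F)" unfolding orth_compl_def by blast
  qed
qed

lemma clinear_onD:
  assumes "clinear_on D T"
  shows "csubspace D" "x \<in> D \<Longrightarrow> y \<in> D \<Longrightarrow> T (x + y) = T x + T y"
    "x \<in> D \<Longrightarrow> T (c *\<^sub>C x) = c *\<^sub>C T x" "x \<in> D \<Longrightarrow> y \<in> D \<Longrightarrow> T (x - y) = T x - T y" "T 0 = 0"
proof -
  show s: "csubspace D" "x \<in> D \<Longrightarrow> y \<in> D \<Longrightarrow> T (x + y) = T x + T y"
    "x \<in> D \<Longrightarrow> T (c *\<^sub>C x) = c *\<^sub>C T x" for x y c
    using assms by (auto simp: clinear_on_def)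
  show "T (x - y) = T x - T y" if "x \<in> D" "y \<in> D"
    using s(2)[OF that(1) csubspaceD(3)[OF s(1) that(2), of "- 1"]] s(3)[OF that(2), of "- 1"] by simp
  show "T 0 = 0" using s(3)[OF csubspaceD(1)[OF s(1)], of 0] by simp
qed

lemma clinear_on_sum:
  assumes T: "clinear_on D T" and "\<And>i. i \<in> A \<Longrightarrow> f i \<in> D"
  shows "T (\<Sum>i\<in>A. f i) = (\<Sum>i\<in>A. T (f i))"
  using assms(2)
proof (induction A rule: infinite_finite_induct)
  case (insert i A)
  then show ?case
    using clinear_onD(2)[OF T, of "f i" "sum f A"] csubspace_sum[OF clinear_onD(1)[OF T], of A f] by auto
qed (use clinear_onD(5)[OF T] in auto)

lemma clinear_on_subset: "clinear_on D T \<Longrightarrow> csubspace S \<Longrightarrow> S \<subseteq> D \<Longrightarrow> clinear_on S T"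
  unfolding clinear_on_def by blast

lemma quadratic_form_expand:
  assumes T: "clinear_on D T" and "x \<in> D" "y \<in> D"
  shows "cinner (T (x + c *\<^sub>C y)) (x + c *\<^sub>C y) = cinner (T x) x + c * cinner (T y) x
    + cnj c * cinner (T x) y + of_real ((cmod c)\<^sup>2) * cinner (T y) y"
  using assms csubspaceD(3)[OF clinear_onD(1)[OF T], of y c]
  by (simp add: clinear_onD[OF T] cinner_simps complex_norm_square algebra_simps del: of_real_power)

lemma quadratic_form_scale:
  assumes T: "clinear_on D T" and "x \<in> D"
  shows "cinner (T (c *\<^sub>C x)) (c *\<^sub>C x) = of_real ((cmod c)\<^sup>2) * cinner (T x) x"
  using assms by (simp add: clinear_onD[OF T] cinner_simps complex_norm_square algebra_simps del: of_real_power)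

subsection \<open>Riesz representation\<close>

text \<open>A vector \<open>g\<close> of least norm on the hyperplane \<open>f = 1\<close> exists by
  completeness, and minimality makes it orthogonal to the kernel of \<open>f\<close>; divided by the
  square of its norm, it represents \<open>f\<close>. Used to transpose a bounded operator against a
  fixed vector.\<close>

lemma riesz_representation:
  fixes f :: "'h::chilbert_space \<Rightarrow> complex"
  assumes add: "\<And>x y. f (x + y) = f x + f y" and scale: "\<And>c x. f (c *\<^sub>C x) = c * f x"
    and bdd: "\<And>x. cmod (f x) \<le> C * norm x"
  shows "\<exists>g. \<forall>x. f x = cinner x g"
proof (cases "\<forall>x. f x = 0")
  case True
  then show ?thesis by (intro exI[of _ 0]) simp
next
  case False
  then obtain x0 where x0: "f x0 \<noteq> 0" by blast
  define S where "S = {x. f x = 1}"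
  have diff: "f (x - y) = f x - f y" for x y using add[of x "(-1) *\<^sub>C y"] scale[of "-1" y] by simp
  have "(1 / f x0) *\<^sub>C x0 \<in> S" using x0 by (simp add: S_def scale)
  then have Sne: "S \<noteq> {}" by blast
  define d where "d = (INF x\<in>S. norm x)"
  have bb: "bdd_below (norm ` S)" by (rule bdd_belowI[of _ 0]) auto
  have d_le: "d \<le> norm x" if "x \<in> S" for x unfolding d_def by (rule cINF_lower[OF bb that])
  have d0: "d \<ge> 0" unfolding d_def by (rule cINF_greatest[OF Sne]) simp
  have "\<exists>u\<in>S. norm u < d + 1 / real (Suc n)" for n
  proof (rule ccontr)
    assume "\<not> ?thesis"
    then have "d + 1 / real (Suc n) \<le> d"
      by (subst (2) d_def, intro cINF_greatest[OF Sne]) (auto simp: not_less)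
    then show False by simp
  qed
  then obtain u where uS: "\<And>n. u n \<in> S" and un: "\<And>n. norm (u n) < d + 1 / real (Suc n)" by metis
  \<comment> \<open>The midpoint of two points of \<open>S\<close> stays in \<open>S\<close>, so the
    parallelogram law makes minimizing sequences Cauchy.\<close>
  have par: "(norm (x - y))\<^sup>2 \<le> 2 * (norm x)\<^sup>2 + 2 * (norm y)\<^sup>2 - 4 * d\<^sup>2" if "x \<in> S" "y \<in> S" for x y
  proof -
    have "(1/2) *\<^sub>C (x + y) \<in> S" using that by (simp add: S_def add scale)
    then have "d \<le> norm ((1/2) *\<^sub>C (x + y))" by (rule d_le)
    then have "2 * d \<le> norm (x + y)" by (simp add: norm_scaleC)
    then have "4 * d\<^sup>2 \<le> (norm (x + y))\<^sup>2" using d0 power_mono[of "2 * d" "norm (x+y)" 2] by simp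
    moreover have "(norm (x - y))\<^sup>2 + (norm (x + y))\<^sup>2 = 2 * (norm x)\<^sup>2 + 2 * (norm y)\<^sup>2"
      using norm_add_scaleC_sq[of x 1 y] norm_add_scaleC_sq[of x "-1" y] by simp
    ultimately show ?thesis by linarith
  qed
  have "Cauchy u"
  proof (rule metric_CauchyI)
    fix e :: real assume e: "e > 0"
    have "(\<lambda>n. 4 * (d + 1 / real (Suc n))\<^sup>2 - 4 * d\<^sup>2) \<longlonglongrightarrow> 4 * (d + 0)\<^sup>2 - 4 * d\<^sup>2"
      by (intro tendsto_intros LIMSEQ_inverse_real_of_nat[unfolded inverse_eq_divide])
    then have "eventually (\<lambda>n. 4 * (d + 1 / real (Suc n))\<^sup>2 - 4 * d\<^sup>2 < e\<^sup>2) sequentially"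
      using order_tendstoD(2)[of _ _ _ "e\<^sup>2"] e by fastforce
    then obtain N where N: "4 * (d + 1 / real (Suc N))\<^sup>2 - 4 * d\<^sup>2 < e\<^sup>2"
      by (auto simp: eventually_sequentially)
    have nn: "(norm (u n))\<^sup>2 \<le> (d + 1 / real (Suc N))\<^sup>2" if "n \<ge> N" for n
    proof (rule power_mono)
      have "1 / real (Suc n) \<le> 1 / real (Suc N)" using that by (simp add: frac_le)
      then show "norm (u n) \<le> d + 1 / real (Suc N)" using un[of n] by linarith
    qed simp
    have "dist (u m) (u n) < e" if "m \<ge> N" "n \<ge> N" for m n
    proof -
      have "(norm (u m - u n))\<^sup>2 < e\<^sup>2" using par[OF uS uS, of m n] nn[OF that(1)] nn[OF that(2)] N by linarith
      then show ?thesis using e by (simp add: dist_norm power_less_imp_less_base)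
    qed
    then show "\<exists>M. \<forall>m\<ge>M. \<forall>n\<ge>M. dist (u m) (u n) < e" by blast
  qed
  then obtain g where g: "u \<longlonglongrightarrow> g" using Cauchy_convergent convergent_def by blast
  have "(\<lambda>n. C * norm (u n - g)) \<longlonglongrightarrow> C * norm (g - g)" by (intro tendsto_intros g)
  then have "(\<lambda>n. C * norm (u n - g)) \<longlonglongrightarrow> 0" by simp
  then have "(\<lambda>n. f (u n - g)) \<longlonglongrightarrow> 0"
    by (rule Lim_null_comparison[rotated]) (simp add: bdd)
  then have "(\<lambda>n. 1 - f g) \<longlonglongrightarrow> 0" using uS by (simp add: diff S_def)
  then have fg: "f g = 1" by (simp add: LIMSEQ_const_iff)
  have "norm g \<le> d"
  proof (rule LIMSEQ_le)
    show "(\<lambda>n. norm (u n)) \<longlonglongrightarrow> norm g" by (intro tendsto_intros g)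
    show "(\<lambda>n. d + 1 / real (Suc n)) \<longlonglongrightarrow> d"
      using tendsto_add[OF tendsto_const[of d] LIMSEQ_inverse_real_of_nat[unfolded inverse_eq_divide]] by simp
    show "\<exists>N. \<forall>n\<ge>N. norm (u n) \<le> d + 1 / real (Suc n)" using un by (meson less_imp_le)
  qed
  then have ng: "norm g \<le> norm x" if "f x = 1" for x using d_le[of x] that by (auto simp: S_def)
  have orth: "cinner k g = 0" if k: "f k = 0" for k
  proof (rule ccontr)
    assume nz: "cinner k g \<noteq> 0"
    then have k0: "norm k > 0" by auto
    \<comment> \<open>This \<open>c\<close> minimizes the norm of \<open>g + c *\<^sub>C k\<close>;
      moving along the kernel keeps \<open>f = 1\<close>, so a nonzero \<open>cinner g k\<close>
      would give a shorter vector.\<close>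
    define c where "c = - (cinner g k / of_real ((norm k)\<^sup>2))"
    have nz': "cinner g k \<noteq> 0" using nz cinner_commute[of g k] by simp
    have "cnj c * cinner g k = - of_real ((cmod (cinner g k))\<^sup>2 / (norm k)\<^sup>2)"
      unfolding c_def by (simp add: complex_norm_square mult.commute del: of_real_power)
    then have r: "Re (cnj c * cinner g k) = - ((cmod (cinner g k))\<^sup>2 / (norm k)\<^sup>2)" by simp
    have m: "(cmod c)\<^sup>2 * (norm k)\<^sup>2 = (cmod (cinner g k))\<^sup>2 / (norm k)\<^sup>2"
      unfolding c_def using k0 by (simp add: norm_divide norm_mult power2_eq_square)
    have "norm g \<le> norm (g + c *\<^sub>C k)" by (rule ng) (simp add: add scale fg k)
    then have "(norm g)\<^sup>2 \<le> (norm (g + c *\<^sub>C k))\<^sup>2" by (simp add: power_mono)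
    then have "(cmod (cinner g k))\<^sup>2 / (norm k)\<^sup>2 \<le> 0"
      unfolding norm_add_scaleC_sq r m by simp
    then show False using k0 nz' by (simp add: divide_le_0_iff)
  qed
  have g0: "norm g \<noteq> 0" using fg bdd[of g] by auto
  have "f x = cinner x ((1 / of_real ((norm g)\<^sup>2)) *\<^sub>C g)" for x
  proof -
    have "cinner (x - f x *\<^sub>C g) g = 0" by (rule orth) (simp add: diff scale fg)
    then have "cinner x g = f x * of_real ((norm g)\<^sup>2)" by (simp add: cinner_simps cinner_self)
    then show ?thesis using g0 by (simp add: cinner_scaleC_right)
  qed
  then show ?thesis by blast
qed

subsection \<open>Orthonormal systems and compact operators\<close>

text \<open>Only the first \<open>n\<close> entries are constrained; the arbitrary tail lets finite
  systems be extended by function update.\<close>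

definition orthonormal :: "nat \<Rightarrow> (nat \<Rightarrow> 'a::complex_inner) \<Rightarrow> bool" where
  "orthonormal n e \<longleftrightarrow> (\<forall>i<n. \<forall>j<n. cinner (e i) (e j) = (if i = j then 1 else 0))"

definition proj :: "nat \<Rightarrow> (nat \<Rightarrow> 'a::complex_inner) \<Rightarrow> 'a \<Rightarrow> 'a" where
  "proj n e x = (\<Sum>i<n. cinner x (e i) *\<^sub>C e i)"

lemma cinner_proj:
  assumes "orthonormal n e" "j < n"
  shows "cinner (proj n e x) (e j) = cinner x (e j)"
proof -
  have "cinner (proj n e x) (e j) = (\<Sum>i<n. cinner x (e i) * (if i = j then 1 else 0))"
    unfolding proj_def cinner_sum_left cinner_scaleC_left
    using assms by (intro sum.cong) (auto simp: orthonormal_def)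
  also have "\<dots> = (\<Sum>i<n. if i = j then cinner x (e i) else 0)"
    by (intro sum.cong) auto
  also have "\<dots> = cinner x (e j)" using assms(2) by simp
  finally show ?thesis .
qed

lemma csubspace_proj_fixed: "csubspace {x. x = proj n e x}"
proof -
  have *: "proj n e (x + y) = proj n e x + proj n e y" "proj n e (c *\<^sub>C x) = c *\<^sub>C proj n e x" for x y c
    by (auto simp: proj_def cinner_simps scaleC_add_left sum.distrib scaleC_sum_right scaleC_scaleC)
  have "x + y = proj n e (x + y)" if "x = proj n e x" "y = proj n e y" for x y
    unfolding *(1) using that by (rule arg_cong2)
  moreover have "c *\<^sub>C x = proj n e (c *\<^sub>C x)" if "x = proj n e x" for c x
    unfolding *(2) using that by (rule arg_cong)
  moreover have "0 = proj n e 0" by (simp add: proj_def)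
  ultimately show ?thesis unfolding csubspace_def by blast
qed

lemma csubspace_proj: "csubspace S \<Longrightarrow> (\<And>i. i < n \<Longrightarrow> e i \<in> S) \<Longrightarrow> proj n e x \<in> S"
  unfolding proj_def by (intro csubspace_sum csubspaceD(3)) auto

lemma orthonormal_append:
  assumes e: "orthonormal n e" and u: "norm u = 1" "\<And>i. i < n \<Longrightarrow> cinner u (e i) = 0"
  shows "orthonormal (Suc n) (e(n := u))"
proof -
  have uu: "cinner u u = 1" using u(1) by (simp add: cinner_self)
  have u': "cinner (e i) u = 0" if "i < n" for i
    using u(2)[OF that] cinner_commute[of "e i" u] by simp
  show ?thesis
    using e u(2) u' uu unfolding orthonormal_def by (auto simp: less_Suc_eq)
qed

lemma proj_append: "proj (Suc n) (e(n := u)) x = proj n e x + cinner x u *\<^sub>C u"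
  unfolding proj_def by simp

text \<open>A generator equal to its own projection is skipped; otherwise its normalized remainder
  is appended. Since the fixed vectors of \<open>proj n e\<close> form a subspace, checking the
  generators suffices.\<close>

lemma gram_schmidt:
  assumes "finite F"
  shows "\<exists>n e. orthonormal n e \<and> (\<forall>x \<in> cspan F. x = proj n e x)"
proof -
  have "\<exists>n e. orthonormal n e \<and> (\<forall>x\<in>F. x = proj n e x)"
    using assms
  proof (induction F)
    case empty
    show ?case by (intro exI[of _ 0]) (auto simp: orthonormal_def)
  next
    case (insert g F)
    then obtain n e where e: "orthonormal n e" and F: "\<And>x. x \<in> F \<Longrightarrow> x = proj n e x" by blast
    show ?case
    proof (cases "g = proj n e g")
      case True
      then show ?thesis using e F by (intro exI[of _ n] exI[of _ e]) auto
    next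
      case False
      define r where "r = g - proj n e g"
      define u where "u = (1 / of_real (norm r)) *\<^sub>C r"
      have r0: "norm r > 0" using False by (simp add: r_def)
      have nu: "norm u = 1" using r0 by (simp add: u_def norm_scaleC norm_divide)
      have ru: "cinner r (e i) = 0" if "i < n" for i
        using cinner_proj[OF e that, of g] by (simp add: r_def cinner_simps)
      then have ue: "cinner u (e i) = 0" if "i < n" for i
        using that by (simp add: u_def cinner_simps)
      have o: "orthonormal (Suc n) (e(n := u))" by (rule orthonormal_append[OF e nu ue])
      have pu: "cinner (proj n e x) u = 0" for x
      proof -
        have "cinner u (proj n e x) = 0"
          unfolding proj_def by (simp add: cinner_sum_right cinner_scaleC_right ue)
        then show ?thesis using cinner_commute[of "proj n e x" u] by simp
      qed
      have "g = proj (Suc n) (e(n := u)) g"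
      proof -
        have "r = of_real (norm r) *\<^sub>C u" using r0 by (simp add: u_def scaleC_scaleC)
        moreover from this have "cinner r u = of_real (norm r)" using nu
          by (metis cinner_scaleC_left cinner_self mult.right_neutral of_real_1 power_one)
        moreover have "cinner g u = cinner r u" using pu[of g] by (simp add: r_def cinner_simps)
        ultimately have "cinner g u *\<^sub>C u = r" by simp
        then show ?thesis by (simp add: proj_append r_def)
      qed
      moreover have "x = proj (Suc n) (e(n := u)) x" if "x \<in> F" for x
        using F[OF that] pu[of x] by (simp add: proj_append)
      ultimately show ?thesis using o by (intro exI[of _ "Suc n"] exI[of _ "e(n := u)"]) blast
    qed
  qed
  then obtain n e where e: "orthonormal n e" and F: "\<And>x. x \<in> F \<Longrightarrow> x = proj n e x" by blast
  have "cspan F \<subseteq> {x. x = proj n e x}"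
    by (rule cspan_minimal[OF csubspace_proj_fixed]) (use F in blast)
  then show ?thesis using e by blast
qed

lemma bessel_inequality:
  assumes e: "orthonormal n e"
  shows "(\<Sum>i<n. (cmod (cinner x (e i)))\<^sup>2) \<le> (norm x)\<^sup>2"
proof -
  define p where "p = proj n e x"
  have o: "cinner (x - p) (e i) = 0" if "i < n" for i
    using cinner_proj[OF e that, of x] by (simp add: p_def cinner_simps)
  have "cinner (x - p) p = 0"
    unfolding p_def proj_def cinner_sum_right cinner_scaleC_right
    using o by (intro sum.neutral) (simp add: p_def proj_def)
  then have "cinner (x - p) (x - p) = cinner x x - cinner p x" by (simp add: cinner_simps)
  also have "cinner p x = (\<Sum>i<n. of_real ((cmod (cinner x (e i)))\<^sup>2))"
    unfolding p_def proj_def cinner_sum_left cinner_scaleC_left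
    by (intro sum.cong refl) (metis cinner_commute complex_norm_square)
  finally have "of_real ((norm (x - p))\<^sup>2)
    = (of_real ((norm x)\<^sup>2 - (\<Sum>i<n. (cmod (cinner x (e i)))\<^sup>2)) :: complex)"
    by (simp only: cinner_self of_real_diff of_real_sum)
  then have "(norm (x - p))\<^sup>2 = (norm x)\<^sup>2 - (\<Sum>i<n. (cmod (cinner x (e i)))\<^sup>2)"
    by (simp only: of_real_eq_iff)
  then show ?thesis by (smt (verit) zero_le_power2)
qed

text \<open>By Bessel's inequality the squared coefficients of any vector are summable, so they tend
  to zero.\<close>

lemma orthonormal_weak_conv_zero:
  assumes "\<And>n. orthonormal n e"
  shows "weak_conv e 0"
  unfolding weak_conv_def
proof
  fix y
  have "summable (\<lambda>i. (cmod (cinner y (e i)))\<^sup>2)"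
  proof (rule bounded_imp_summable)
    show "(\<Sum>i\<le>n. (cmod (cinner y (e i)))\<^sup>2) \<le> (norm y)\<^sup>2" for n
      using bessel_inequality[OF assms, of y "Suc n"] by (simp only: lessThan_Suc_atMost)
  qed simp
  then have "(\<lambda>i. (cmod (cinner y (e i)))\<^sup>2) \<longlonglongrightarrow> 0" by (rule summable_LIMSEQ_zero)
  then have "(\<lambda>i. sqrt ((cmod (cinner y (e i)))\<^sup>2)) \<longlonglongrightarrow> sqrt 0" by (rule tendsto_real_sqrt)
  then have "(\<lambda>i. cmod (cinner (e i) y)) \<longlonglongrightarrow> 0"
    by (subst cinner_commute) simp
  then show "(\<lambda>n. cinner (e n) y) \<longlonglongrightarrow> cinner 0 y" by (simp add: tendsto_norm_zero_iff)
qed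

text \<open>Induction on \<open>n\<close>: each step adds the continuous image of a closed disc, and
  sums of compact sets are compact.\<close>

lemma compact_bounded_combinations:
  fixes e :: "nat \<Rightarrow> 'a::complex_inner"
  shows "compact {x. \<exists>c. (\<forall>i<n. cmod (c i) \<le> R) \<and> x = (\<Sum>i<n. c i *\<^sub>C e i)}" (is "compact (?S n)")
proof (induction n)
  case 0
  have "?S 0 = {0}" by auto
  then show ?case by simp
next
  case (Suc n)
  have "continuous_on (cball 0 R) (\<lambda>c. c *\<^sub>C e n)"
    by (auto simp: continuous_on_def intro!: tendsto_scaleC tendsto_ident_at)
  then have "compact ((\<lambda>c. c *\<^sub>C e n) ` cball 0 R)"
    by (intro compact_continuous_image) auto
  from compact_sums[OF Suc this]
  have "compact {x + y |x y. x \<in> ?S n \<and> y \<in> (\<lambda>c. c *\<^sub>C e n) ` cball 0 R}" .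
  also have "{x + y |x y. x \<in> ?S n \<and> y \<in> (\<lambda>c. c *\<^sub>C e n) ` cball 0 R} = ?S (Suc n)"
  proof (intro set_eqI iffI)
    fix z assume "z \<in> {x + y |x y. x \<in> ?S n \<and> y \<in> (\<lambda>c. c *\<^sub>C e n) ` cball 0 R}"
    then obtain c d where c: "\<forall>i<n. cmod (c i) \<le> R" "cmod d \<le> R"
      and z: "z = (\<Sum>i<n. c i *\<^sub>C e i) + d *\<^sub>C e n" by auto
    show "z \<in> ?S (Suc n)"
      using c z by (intro CollectI exI[of _ "c(n := d)"]) (auto simp: less_Suc_eq)
  next
    fix z assume "z \<in> ?S (Suc n)"
    then obtain c where c: "\<forall>i<Suc n. cmod (c i) \<le> R" and z: "z = (\<Sum>i<n. c i *\<^sub>C e i) + c n *\<^sub>C e n"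
      by auto
    from c have "(\<Sum>i<n. c i *\<^sub>C e i) \<in> ?S n" by (intro CollectI exI[of _ c]) simp
    moreover from c have "c n *\<^sub>C e n \<in> (\<lambda>c. c *\<^sub>C e n) ` cball 0 R" by auto
    ultimately
    show "z \<in> {x + y |x y. x \<in> ?S n \<and> y \<in> (\<lambda>c. c *\<^sub>C e n) ` cball 0 R}" using z by blast
  qed
  finally show ?case .
qed

text \<open>Expanding in an orthonormal system puts the image of the unit ball into a compact set of
  combinations with bounded coefficients. The bound is \<open>\<bar>C\<bar>\<close> because nothing
  fixes the sign of \<open>C\<close>.\<close>

lemma finite_rank_imp_compact_op:
  assumes K: "cbounded_linear K" "finite_rank K"
  shows "compact_op K"
proof -
  obtain F where F: "finite F" "range K \<subseteq> cspan F" using K(2) by (auto simp: finite_rank_def)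
  obtain n e where e: "orthonormal n e" and p: "\<And>x. x \<in> cspan F \<Longrightarrow> x = proj n e x"
    using gram_schmidt[OF F(1)] by blast
  obtain C where C: "\<And>x. norm (K x) \<le> C * norm x" using K(1) by (auto simp: cbounded_linear_def)
  define S where "S = {x. \<exists>c. (\<forall>i<n. cmod (c i) \<le> \<bar>C\<bar>) \<and> x = (\<Sum>i<n. c i *\<^sub>C e i)}"
  have S: "compact S" unfolding S_def by (rule compact_bounded_combinations)
  have "K ` cball 0 1 \<subseteq> S"
  proof
    fix y assume "y \<in> K ` cball 0 1"
    then obtain x where x: "norm x \<le> 1" "y = K x" by auto
    have "norm y \<le> \<bar>C\<bar>"
    proof -
      have "norm y \<le> C * norm x" using C x(2) by simp
      also have "\<dots> \<le> \<bar>C\<bar> * norm x" by (intro mult_right_mono) auto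
      also have "\<dots> \<le> \<bar>C\<bar>" using x(1) by (intro mult_left_le) auto
      finally show ?thesis .
    qed
    moreover have "norm (e i) = 1" if "i < n" for i
      using e that by (simp add: orthonormal_def norm_eq_sqrt_cinner)
    ultimately have "cmod (cinner y (e i)) \<le> \<bar>C\<bar>" if "i < n" for i
      using cinner_cauchy_schwarz[of y "e i"] that by simp
    moreover have "y \<in> cspan F" using F(2) x(2) by auto
    from p[OF this] have "y = (\<Sum>i<n. cinner y (e i) *\<^sub>C e i)" by (simp only: proj_def)
    ultimately show "y \<in> S"
      unfolding S_def by (intro CollectI exI[of _ "\<lambda>i. cinner y (e i)"] conjI allI impI)
  qed
  then have "closure (K ` cball 0 1) \<subseteq> S"
    using S by (simp add: closure_minimal compact_imp_closed)
  then show ?thesis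
    unfolding compact_op_def using S compact_Int_closed[of S "closure (K ` cball 0 1)"] by (simp add: Int_absorb1)
qed

text \<open>Along a subsequence kept away from zero, compactness gives a limit \<open>l\<close>. By
  Riesz, \<open>cinner (K x) l\<close> is an inner product of \<open>x\<close> with a fixed vector
  and tends to zero along the sequence, so \<open>cinner l l = 0\<close>, a contradiction.\<close>

lemma compact_op_weak_null:
  fixes K :: "'h::chilbert_space \<Rightarrow> 'h"
  assumes K: "cbounded_linear K" "compact_op K" and x: "weak_conv x 0" "\<And>n. norm (x n) = 1"
  shows "(\<lambda>n. K (x n)) \<longlonglongrightarrow> 0"
proof (rule ccontr)
  assume "\<not> ?thesis"
  then obtain \<epsilon> where eps: "\<epsilon> > 0" and "\<not> eventually (\<lambda>n. norm (K (x n)) < \<epsilon>) sequentially"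
    by (auto simp: tendsto_iff)
  then have "\<forall>N. \<exists>n\<ge>N. norm (K (x n)) \<ge> \<epsilon>"
    by (auto simp: eventually_sequentially not_less)
  then have "infinite {n. norm (K (x n)) \<ge> \<epsilon>}"
    by (metis (mono_tags, lifting) infinite_nat_iff_unbounded_le mem_Collect_eq)
  from infinite_enumerate[OF this]
  obtain r :: "nat \<Rightarrow> nat" where r: "strict_mono r" and rn: "\<And>n. norm (K (x (r n))) \<ge> \<epsilon>" by auto
  have "\<forall>n. K (x (r n)) \<in> closure (K ` cball 0 1)"
    using x(2) by (intro allI subsetD[OF closure_subset]) auto
  then obtain l s where s: "strict_mono s" and l: "((\<lambda>n. K (x (r n))) \<circ> s) \<longlonglongrightarrow> l"
    using K(2)[unfolded compact_op_def compact_def, rule_format, of "\<lambda>n. K (x (r n))"] by auto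
  have lin: "clinear_on UNIV K" using K(1) by (simp add: cbounded_linear_def)
  obtain C where C: "\<And>x. norm (K x) \<le> C * norm x" using K(1) by (auto simp: cbounded_linear_def)
  have "\<exists>g. \<forall>x. cinner (K x) l = cinner x g"
  proof (rule riesz_representation)
    show "cmod (cinner (K x) l) \<le> (C * norm l) * norm x" for x
      using cinner_cauchy_schwarz[of "K x" l] mult_right_mono[OF C[of x], of "norm l"] by (simp add: mult_ac)
  qed (simp_all add: clinear_onD[OF lin] cinner_simps)
  then obtain g where g: "\<And>x. cinner (K x) l = cinner x g" by blast
  have "(\<lambda>n. cinner (x n) g) \<longlonglongrightarrow> 0" using x(1) by (simp add: weak_conv_def)
  then have "(\<lambda>n. cinner (x ((r \<circ> s) n)) g) \<longlonglongrightarrow> 0"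
    using LIMSEQ_subseq_LIMSEQ[OF _ strict_mono_o[OF r s], of "\<lambda>n. cinner (x n) g"] by (simp add: o_def)
  moreover have "(\<lambda>n. cinner (x ((r \<circ> s) n)) g) \<longlonglongrightarrow> cinner l l"
    using tendsto_cinner[OF l tendsto_const[of l]] by (simp add: o_def g)
  ultimately have "cinner l l = 0" using LIMSEQ_unique by blast
  then have "l = 0" by (simp add: cinner_eq_zero_iff)
  moreover have "(\<lambda>n. norm (((\<lambda>n. K (x (r n))) \<circ> s) n)) \<longlonglongrightarrow> norm l" by (rule tendsto_norm[OF l])
  then have "norm l \<ge> \<epsilon>" by (rule LIMSEQ_le_const) (use rn in auto)
  ultimately show False using eps by simp
qed

section \<open>Points outside the closed numerical range, in homogeneous form\<close>

lemma num_range_normalize: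
  assumes T: "clinear_on D T" and x: "x \<in> D" "x \<noteq> 0"
  shows "cinner (T x) x / of_real ((norm x)\<^sup>2) \<in> num_range D T"
proof -
  define c where "c = complex_of_real (1 / norm x)"
  have c: "(cmod c)\<^sup>2 = 1 / (norm x)\<^sup>2" "norm (c *\<^sub>C x) = 1"
    using x by (simp_all add: c_def norm_scaleC norm_divide power_divide)
  have "cinner (T (c *\<^sub>C x)) (c *\<^sub>C x) = cinner (T x) x / of_real ((norm x)\<^sup>2)"
    unfolding quadratic_form_scale[OF T x(1)] c by simp
  then show ?thesis
    unfolding num_range_def using c(2) csubspaceD(3)[OF clinear_onD(1)[OF T] x(1), of c] by force
qed

text \<open>The homogeneous bound replaces unit vectors by all of \<open>D\<close>, zero included,
  so that vectors can be added and split without renormalizing.\<close>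

lemma notin_closure_num_range_iff:
  assumes T: "clinear_on D T"
  shows "l \<notin> closure (num_range D T) \<longleftrightarrow>
    (\<exists>\<delta>>0. \<forall>x\<in>D. \<delta> * (norm x)\<^sup>2 \<le> cmod (cinner (T x) x - l * of_real ((norm x)\<^sup>2)))" (is "?L \<longleftrightarrow> ?R")
proof
  assume ?L
  then obtain \<delta> where d: "\<delta> > 0" "\<And>w. w \<in> num_range D T \<Longrightarrow> \<delta> \<le> dist w l"
    unfolding closure_approachable by (auto simp: not_less)
  have "\<delta> * (norm x)\<^sup>2 \<le> cmod (cinner (T x) x - l * of_real ((norm x)\<^sup>2))" if x: "x \<in> D" for x
  proof (cases "x = 0")
    case False
    from d(2)[OF num_range_normalize[OF T x False]]
    have "\<delta> \<le> cmod (cinner (T x) x / of_real ((norm x)\<^sup>2) - l)"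
      by (simp only: dist_norm)
    also have "cinner (T x) x / of_real ((norm x)\<^sup>2) - l
      = (cinner (T x) x - l * of_real ((norm x)\<^sup>2)) / of_real ((norm x)\<^sup>2)"
      using False by (simp add: field_simps)
    also have "cmod \<dots> = cmod (cinner (T x) x - l * of_real ((norm x)\<^sup>2)) / (norm x)\<^sup>2"
      by (simp add: norm_divide norm_power)
    finally show ?thesis using False by (simp add: field_simps)
  qed (simp add: clinear_onD[OF T])
  then show ?R using d(1) by blast
next
  assume ?R
  then obtain \<delta> where d: "\<delta> > 0"
    "\<And>x. x \<in> D \<Longrightarrow> \<delta> * (norm x)\<^sup>2 \<le> cmod (cinner (T x) x - l * of_real ((norm x)\<^sup>2))" by blast
  have "\<delta> \<le> dist w l" if "w \<in> num_range D T" for w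
    using that d(2) unfolding num_range_def by (force simp: dist_norm)
  then show ?L unfolding closure_approachable using d(1) by (meson not_less)
qed

subsection \<open>Convexity of the numerical range\<close>

text \<open>\<open>Im (cnj \<omega> * B) = - Im (\<omega> * cnj B)\<close>, so only
  \<open>\<omega> * (A - cnj B)\<close> has to be rotated onto the real axis. This is the device for
  making the cross terms of a sesquilinear form real.\<close>

lemma exists_phase_Im_zero:
  "\<exists>\<omega>. cmod \<omega> = 1 \<and> Im (\<omega> * A + cnj \<omega> * B) = 0"
proof (cases "A = cnj B")
  case True
  then show ?thesis by (intro exI[of _ 1]) simp
next
  case False
  define Z where "Z = A - cnj B"
  define \<omega> where "\<omega> = cnj Z / of_real (cmod Z)"
  have Z: "cmod Z \<noteq> 0" using False by (simp add: Z_def)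
  have "cmod \<omega> = 1" using Z by (simp add: \<omega>_def norm_divide)
  moreover have "Im (\<omega> * A + cnj \<omega> * B) = Im (\<omega> * Z)"
    by (simp add: Z_def algebra_simps)
  moreover have "\<omega> * Z = of_real ((cmod Z)\<^sup>2) / of_real (cmod Z)"
    unfolding \<omega>_def complex_norm_square by (simp add: mult.commute)
  then have "Im (\<omega> * Z) = 0" by (simp flip: of_real_divide of_real_power)
  ultimately show ?thesis by auto
qed

text \<open>The Toeplitz-Hausdorff theorem. After an affine change taking two given values to 0 and
  1, a suitable phase makes the form real along a path joining the two vectors, and the intermediate
  value theorem reaches every value in between.\<close>

theorem convex_num_range:
  assumes T: "clinear_on D T"
  shows "convex (num_range D T)"
proof -
  have seg: "p + of_real t * (r - p) \<in> num_range D T"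
    if p: "p \<in> num_range D T" and r: "r \<in> num_range D T" and t: "0 \<le> t" "t \<le> 1" and ne: "p \<noteq> r" for p r t
  proof -
    obtain x y where x: "x \<in> D" "norm x = 1" "p = cinner (T x) x"
      and y: "y \<in> D" "norm y = 1" "r = cinner (T y) y"
      using p r by (auto simp: num_range_def)
    define \<kappa> where "\<kappa> = 1 / (r - p)"
    \<comment> \<open>The sesquilinear form of \<open>T - p\<close> multiplied by
      \<open>\<kappa>\<close>: it takes the value 0 at \<open>x\<close> and 1 at
      \<open>y\<close>.\<close>
    define G where "G u w = \<kappa> * (cinner (T u) w - p * cinner u w)" for u w
    obtain \<omega> where w: "cmod \<omega> = 1" and im: "Im (\<omega> * G x y + cnj \<omega> * G y x) = 0"
      using exists_phase_Im_zero by blast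
    define h where "h = Re (\<omega> * G x y + cnj \<omega> * G y x)"
    define z where "z s = of_real s *\<^sub>C y + of_real (1 - s) *\<^sub>C \<omega> *\<^sub>C x" for s
    note sub = clinear_onD(1)[OF T]
    have zD: "z s \<in> D" for s unfolding z_def using x y by (intro csubspaceD[OF sub])
    have Gx: "G x x = 0" and Gy: "G y y = 1" using x y ne by (simp_all add: G_def \<kappa>_def cinner_self)
    have "G (z s) (z s) = of_real (s\<^sup>2) * G y y + of_real ((1 - s) * s) * (\<omega> * G x y + cnj \<omega> * G y x)
      + of_real ((1 - s)\<^sup>2) * (\<omega> * cnj \<omega>) * G x x" for s
    proof -
      have "T (z s) = of_real s *\<^sub>C T y + of_real (1 - s) *\<^sub>C \<omega> *\<^sub>C T x"
        unfolding z_def using x y by (simp add: clinear_onD[OF T] csubspaceD[OF sub] scaleC_scaleC)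
      then have "cinner (T (z s)) (z s) = of_real (s\<^sup>2) * cinner (T y) y
        + of_real ((1 - s) * s) * (\<omega> * cinner (T x) y + cnj \<omega> * cinner (T y) x)
        + of_real ((1 - s)\<^sup>2) * (\<omega> * cnj \<omega>) * cinner (T x) x"
        unfolding z_def by (simp add: cinner_simps power2_eq_square) (simp add: algebra_simps)
      moreover have "cinner (z s) (z s) = of_real (s\<^sup>2) * cinner y y
        + of_real ((1 - s) * s) * (\<omega> * cinner x y + cnj \<omega> * cinner y x)
        + of_real ((1 - s)\<^sup>2) * (\<omega> * cnj \<omega>) * cinner x x"
        unfolding z_def by (simp add: cinner_simps power2_eq_square) (simp add: algebra_simps)
      ultimately show ?thesis
        unfolding G_def by (simp only: ring_distribs mult_ac) (simp add: algebra_simps)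
    qed
    moreover have "\<omega> * G x y + cnj \<omega> * G y x = of_real h" using im by (simp add: complex_eq_iff h_def)
    ultimately have Gz: "G (z s) (z s) = of_real (s\<^sup>2 + (1 - s) * s * h)" for s
      by (simp add: Gx Gy)
    \<comment> \<open>If the path met zero, \<open>x\<close> and \<open>y\<close> would be
      proportional; \<open>G y y = 1\<close> and \<open>G x x = 0\<close> then force
      \<open>s = 0\<close>, where the path is at a unimodular multiple of the unit vector
      \<open>x\<close>.\<close>
    have z0: "z s \<noteq> 0" for s
    proof
      assume "z s = 0"
      then have e: "of_real s *\<^sub>C y = - (of_real (1 - s) *\<^sub>C \<omega> *\<^sub>C x)"
        by (simp add: z_def eq_neg_iff_add_eq_0)
      define c where "c = - (of_real (1 - s) * \<omega>)"
      have e: "of_real s *\<^sub>C y = c *\<^sub>C x" using e by (simp add: c_def scaleC_scaleC)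
      have GG: "G (k *\<^sub>C u) (k *\<^sub>C u) = k * cnj k * G u u" if "u \<in> D" for k u
        using that by (simp add: G_def clinear_onD[OF T] cinner_simps algebra_simps)
      have "of_real s * cnj (of_real s) * G y y = 0"
        using GG[OF y(1), of "of_real s"] GG[OF x(1), of c] by (simp add: e Gx)
      then have "s = 0" by (simp add: Gy)
      then have "c *\<^sub>C x = 0" using e by simp
      then have "norm (c *\<^sub>C x) = 0" by simp
      then show False using x(2) w \<open>s = 0\<close> by (simp add: norm_scaleC c_def)
    qed
    define f where "f s = (s\<^sup>2 + (1 - s) * s * h) / (norm (z s))\<^sup>2" for s
    have contz: "continuous_on {0..1} z"
      unfolding z_def continuous_on_def by (intro ballI tendsto_intros tendsto_scaleC tendsto_ident_at)
    have "continuous_on {0..1} f"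
      unfolding f_def using z0 by (intro continuous_intros contz) auto
    moreover have "f 0 \<le> t" "t \<le> f 1" using t y by (simp_all add: f_def z_def)
    ultimately obtain s where s: "f s = t" using IVT'[of f 0 t 1] by auto
    define c where "c = complex_of_real (1 / norm (z s))"
    have c: "(cmod c)\<^sup>2 = 1 / (norm (z s))\<^sup>2" "norm (c *\<^sub>C z s) = 1"
      using z0 by (simp_all add: c_def norm_scaleC norm_divide power_divide)
    have "cinner (T (z s)) (z s) = p * of_real ((norm (z s))\<^sup>2) + (r - p) * G (z s) (z s)"
      using ne by (simp add: G_def \<kappa>_def cinner_self)
    also have "G (z s) (z s) = of_real t * of_real ((norm (z s))\<^sup>2)"
      unfolding Gz s[symmetric] f_def using z0 by (simp flip: of_real_mult)
    finally have "cinner (T (c *\<^sub>C z s)) (c *\<^sub>C z s) = p + of_real t * (r - p)"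
      unfolding quadratic_form_scale[OF T zD] c using z0 by (simp add: field_simps)
    then show ?thesis
      unfolding num_range_def using c(2) csubspaceD(3)[OF sub zD] by (metis (mono_tags, lifting) mem_Collect_eq)
  qed
  show ?thesis
  proof (rule convexI)
    fix p r u v :: _ assume *: "p \<in> num_range D T" "r \<in> num_range D T" "0 \<le> u" "0 \<le> v" "u + v = (1::real)"
    show "u *\<^sub>R p + v *\<^sub>R r \<in> num_range D T"
    proof (cases "p = r")
      case True
      then show ?thesis using * by (simp flip: scaleR_left_distrib)
    next
      case False
      have u: "u = 1 - v" using * by simp
      have "u *\<^sub>R p + v *\<^sub>R r = p + of_real v * (r - p)"
        unfolding u by (simp add: scaleR_conv_of_real algebra_simps)
      then show ?thesis using seg[OF *(1,2) *(4) _ False] * by simp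
    qed
  qed
qed

section \<open>Coordinates for a finite-codimensional subspace of the domain\<close>

text \<open>Induction over \<open>F\<close>: a new \<open>u\<close> that vanishes on the current
  intersection adds nothing; otherwise a vector it detects becomes the new \<open>d m\<close>, and
  \<open>u\<close> is corrected to annihilate the earlier \<open>d i\<close>. As the
  \<open>d i\<close> lie in \<open>D\<close>, \<open>T\<close> can be applied to them, and they span
  a complement inside the domain.\<close>

lemma biorthogonal_system:
  fixes D :: "'a::complex_inner set"
  assumes D: "csubspace D" and F: "finite F"
  shows "\<exists>(m::nat) v d. (\<forall>i<m. d i \<in> D) \<and> (\<forall>i<m. \<forall>j<m. cinner (d i) (v j) = (if i = j then 1 else 0)) \<and>
    {x\<in>D. \<forall>j<m. cinner x (v j) = 0} = {x\<in>D. \<forall>u\<in>F. cinner x u = 0}"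
  using F
proof (induction F)
  case empty
  show ?case by (intro exI[of _ 0]) auto
next
  case (insert u F)
  then obtain m :: nat and v d :: "nat \<Rightarrow> 'a" where d: "\<And>i. i < m \<Longrightarrow> d i \<in> D"
    and dv: "\<And>i j. i < m \<Longrightarrow> j < m \<Longrightarrow> cinner (d i) (v j) = (if i = j then 1 else 0)"
    and eq: "{x\<in>D. \<forall>j<m. cinner x (v j) = 0} = {x\<in>D. \<forall>u\<in>F. cinner x u = 0}" by blast
  show ?case
  proof (cases "\<exists>x\<in>D. (\<forall>j<m. cinner x (v j) = 0) \<and> cinner x u \<noteq> 0")
    case False
    then have "{x\<in>D. \<forall>j<m. cinner x (v j) = 0} = {x\<in>D. \<forall>u\<in>insert u F. cinner x u = 0}"
      using eq by blast
    then show ?thesis using d dv by (intro exI[of _ m] exI[of _ v] exI[of _ d]) auto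
  next
    case True
    then obtain x where x: "x \<in> D" "\<And>j. j < m \<Longrightarrow> cinner x (v j) = 0" "cinner x u \<noteq> 0" by blast
    define x0 where "x0 = (1 / cinner x u) *\<^sub>C x"
    have x0: "x0 \<in> D" "\<And>j. j < m \<Longrightarrow> cinner x0 (v j) = 0" "cinner x0 u = 1"
      using x csubspaceD(3)[OF D] by (auto simp: x0_def cinner_simps)
    define v' where "v' = u - (\<Sum>j<m. cnj (cinner (d j) u) *\<^sub>C v j)"
    have xv': "cinner z v' = cinner z u - (\<Sum>j<m. cinner (d j) u * cinner z (v j))" for z
      by (simp add: v'_def cinner_simps cinner_sum_right)
    have dv': "cinner (d i) v' = 0" if "i < m" for i
    proof -
      have "(\<Sum>j<m. cinner (d j) u * cinner (d i) (v j)) = (\<Sum>j<m. if j = i then cinner (d j) u else 0)"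
        using that by (intro sum.cong) (auto simp: dv)
      then show ?thesis using that by (simp add: xv')
    qed
    have x0v': "cinner x0 v' = 1" by (simp add: xv' x0)
    have "{x\<in>D. \<forall>j<Suc m. cinner x ((v(m := v')) j) = 0} = {x\<in>D. (\<forall>j<m. cinner x (v j) = 0) \<and> cinner x u = 0}"
      by (auto simp: less_Suc_eq xv')
    also have "\<dots> = {x\<in>D. \<forall>u\<in>insert u F. cinner x u = 0}" using eq by blast
    finally show ?thesis
      using d x0 dv dv' x0v'
      by (intro exI[of _ "Suc m"] exI[of _ "v(m := v')"] exI[of _ "d(m := x0)"]) (auto simp: less_Suc_eq)
  qed
qed

section \<open>Forms with values in a half-plane: tilting and balancing\<close>

text \<open>When one boundary direction of the half-plane is avoided, a slight rotation makes the
  real part control the modulus: on one side of the real axis the rotation gains, on the other the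
  sector condition absorbs its cost.\<close>

lemma sector_tilt:
  fixes q :: "'b \<Rightarrow> complex" and N :: "'b \<Rightarrow> real" and \<sigma> :: real
  assumes sg: "\<sigma> = 1 \<or> \<sigma> = -1" and b: "b > 0" and N: "\<And>x. 0 \<le> N x" and \<epsilon>: "\<epsilon> > 0"
    and re: "\<And>x. x \<in> D \<Longrightarrow> b * N x \<le> Re (q x)"
    and sec: "\<And>x. x \<in> D \<Longrightarrow> \<sigma> * Im (q x) < 0 \<Longrightarrow> - \<epsilon> * (\<sigma> * Im (q x)) \<le> Re (q x)"
  shows "\<exists>\<beta> b' C. \<beta> \<noteq> 0 \<and> b' > 0 \<and> C \<ge> 0 \<and> (\<forall>x\<in>D. b' * N x \<le> Re (\<beta> * q x)) \<and>
    (\<forall>x\<in>D. cmod (q x) \<le> C * Re (\<beta> * q x))"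
proof -
  \<comment> \<open>Half of \<open>\<epsilon>\<close>: on the side where the rotation costs, at most
    half of \<open>Re (q x)\<close> is lost.\<close>
  define \<beta> where "\<beta> = Complex 1 (- (\<sigma> * (\<epsilon> / 2)))"
  have rb: "Re (\<beta> * q x) = Re (q x) + \<epsilon> / 2 * (\<sigma> * Im (q x))" for x
    by (simp add: \<beta>_def algebra_simps)
  have main: "Re (q x) \<le> 2 * Re (\<beta> * q x) \<and> \<bar>Im (q x)\<bar> \<le> 2 / \<epsilon> * Re (\<beta> * q x)" if x: "x \<in> D" for x
  proof -
    define s where "s = \<sigma> * Im (q x)"
    have s: "\<bar>Im (q x)\<bar> = \<bar>s\<bar>" using sg by (auto simp: s_def)
    have a: "0 \<le> Re (q x)" using re[OF x] b N[of x] by (meson mult_nonneg_nonneg less_imp_le order_trans)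
    have "Re (q x) \<le> 2 * Re (\<beta> * q x) \<and> \<epsilon> * \<bar>s\<bar> \<le> 2 * Re (\<beta> * q x)"
    proof (cases "s < 0")
      case True
      then have "- \<epsilon> * s \<le> Re (q x)" using sec[OF x] by (simp add: s_def)
      then show ?thesis unfolding rb s_def[symmetric] using True by simp
    next
      case False
      then have "0 \<le> \<epsilon> * s" using \<epsilon> by simp
      then show ?thesis unfolding rb s_def[symmetric] using False a by simp
    qed
    then show ?thesis unfolding s using \<epsilon> by (simp add: field_simps)
  qed
  have "(b / 2) * N x \<le> Re (\<beta> * q x)" if "x \<in> D" for x
    using main[OF that] re[OF that] by linarith
  moreover have "cmod (q x) \<le> (2 + 2 / \<epsilon>) * Re (\<beta> * q x)" if x: "x \<in> D" for x
  proof -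
    have "0 \<le> Re (q x)" using re[OF x] b N[of x] by (meson mult_nonneg_nonneg less_imp_le order_trans)
    then have "cmod (q x) \<le> Re (q x) + \<bar>Im (q x)\<bar>" using cmod_le[of "q x"] by simp
    then show ?thesis using main[OF x] by (simp add: distrib_right)
  qed
  moreover have "\<beta> \<noteq> 0" by (auto simp: \<beta>_def complex_eq_iff)
  moreover have "2 + 2 / \<epsilon> \<ge> 0" using \<epsilon> by simp
  moreover have "b / 2 > 0" using b by simp
  ultimately show ?thesis by blast
qed

text \<open>If the numerical range approaches both boundary directions of the half-plane, no tilt helps; but
  then the imaginary part of \<open>\<langle>Ty, y\<rangle>\<close> can be cancelled by adding to \<open>y\<close> a vector with opposite
  imaginary part and negligible real part, with the phase chosen so that the cross terms are real.\<close>

lemma half_plane_cancel_Im: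
  assumes T: "clinear_on D T"
    and re: "\<And>x. x \<in> D \<Longrightarrow> 0 \<le> Re (cinner (T x) x)"
    and pos: "\<And>\<epsilon>. \<epsilon> > 0 \<Longrightarrow> \<exists>x\<in>D. 0 < Im (cinner (T x) x) \<and> Re (cinner (T x) x) < \<epsilon> * Im (cinner (T x) x)"
    and neg: "\<And>\<epsilon>. \<epsilon> > 0 \<Longrightarrow> \<exists>x\<in>D. Im (cinner (T x) x) < 0 \<and> Re (cinner (T x) x) < \<epsilon> * - Im (cinner (T x) x)"
    and y: "y \<in> D" and \<epsilon>: "\<epsilon> > 0"
  shows "\<exists>y'\<in>D. cmod (cinner (T y) f) \<le> cmod (cinner (T y') f) \<and>
    cmod (cinner (T y') y') \<le> 2 * Re (cinner (T y) y) + \<epsilon>"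
proof (cases "Im (cinner (T y) y) = 0")
  case True
  then have "cmod (cinner (T y) y) = Re (cinner (T y) y)" using re[OF y] by (simp add: cmod_def)
  then show ?thesis using re[OF y] \<epsilon> by (intro bexI[of _ y] conjI) (auto simp: y)
next
  case False
  note sub = clinear_onD(1)[OF T]
  define B where "B = Im (cinner (T y) y)"
  \<comment> \<open>A vector whose imaginary part has the sign opposite to \<open>B\<close> and
    which is so close to the boundary that, rescaled to cancel \<open>B\<close>, its real part stays
    below \<open>\<epsilon> / 2\<close>.\<close>
  have "\<exists>x\<in>D. Im (cinner (T x) x) / B < 0 \<and> Re (cinner (T x) x) < \<epsilon> / (2 * \<bar>B\<bar>) * \<bar>Im (cinner (T x) x)\<bar>"
  proof (cases "B > 0")
    case True
    then have "\<epsilon> / (2 * \<bar>B\<bar>) > 0" using \<epsilon> by simp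
    from neg[OF this] show ?thesis using True by (auto simp: divide_less_0_iff)
  next
    case B: False
    then have B: "B < 0" using False by (simp add: B_def)
    then have "\<epsilon> / (2 * \<bar>B\<bar>) > 0" using \<epsilon> by (intro divide_pos_pos) auto
    from pos[OF this] show ?thesis using B by (metis abs_of_pos divide_less_0_iff)
  qed
  then obtain x where x: "x \<in> D" and xB: "Im (cinner (T x) x) / B < 0"
    and xr: "Re (cinner (T x) x) < \<epsilon> / (2 * \<bar>B\<bar>) * \<bar>Im (cinner (T x) x)\<bar>" by blast
  define X where "X = Im (cinner (T x) x)"
  define c where "c = complex_of_real (sqrt (\<bar>B\<bar> / \<bar>X\<bar>))"
  have X0: "X \<noteq> 0" using xB by (auto simp: X_def)
  have B0: "B \<noteq> 0" using False by (simp add: B_def)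
  have c: "(cmod c)\<^sup>2 = \<bar>B\<bar> / \<bar>X\<bar>" by (simp add: c_def)
  define u where "u = c *\<^sub>C x"
  have u: "u \<in> D" using x csubspaceD(3)[OF sub] by (simp add: u_def)
  have qu: "cinner (T u) u = of_real (\<bar>B\<bar> / \<bar>X\<bar>) * cinner (T x) x"
    unfolding u_def quadratic_form_scale[OF T x] c ..
  have uI: "Im (cinner (T u) u) = - B"
    using xB X0 B0 unfolding qu X_def[symmetric]
    by (auto simp: X_def[symmetric] abs_if divide_less_0_iff)
  have uR: "Re (cinner (T u) u) < \<epsilon> / 2"
  proof -
    have "\<bar>B\<bar> / \<bar>X\<bar> * Re (cinner (T x) x) < \<bar>B\<bar> / \<bar>X\<bar> * (\<epsilon> / (2 * \<bar>B\<bar>) * \<bar>X\<bar>)"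
      using xr X0 B0 unfolding X_def[symmetric] by (intro mult_strict_left_mono) auto
    also have "\<dots> = \<epsilon> / 2" using X0 B0 by simp
    finally show ?thesis unfolding qu by simp
  qed
  \<comment> \<open>With this phase the cross terms form a real number \<open>h\<close>, so the
    forms at the two vectors obtained by adding \<open>\<omega>\<close> or \<open>- \<omega>\<close>
    times \<open>u\<close> to \<open>y\<close> are the reals \<open>a + h\<close> and
    \<open>a - h\<close>. Both are nonnegative, hence at most \<open>2 * a\<close>.\<close>
  obtain \<omega> where w: "cmod \<omega> = 1"
    and im: "Im (\<omega> * cinner (T u) y + cnj \<omega> * cinner (T y) u) = 0"
    using exists_phase_Im_zero by blast
  define h where "h = Re (\<omega> * cinner (T u) y + cnj \<omega> * cinner (T y) u)"
  have h: "\<omega> * cinner (T u) y + cnj \<omega> * cinner (T y) u = of_real h" using im by (simp add: h_def complex_eq_iff)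
  define a where "a = Re (cinner (T y) y) + Re (cinner (T u) u)"
  have qq: "cinner (T y) y + cinner (T u) u = of_real a" using uI by (simp add: a_def complex_eq_iff B_def)
  have p1: "cinner (T (y + \<omega> *\<^sub>C u)) (y + \<omega> *\<^sub>C u) = of_real (a + h)"
    unfolding quadratic_form_expand[OF T y u] of_real_add h[symmetric] qq[symmetric] w by simp
  have p2: "cinner (T (y + (- \<omega>) *\<^sub>C u)) (y + (- \<omega>) *\<^sub>C u) = of_real (a - h)"
    unfolding quadratic_form_expand[OF T y u] of_real_diff h[symmetric] qq[symmetric] norm_minus_cancel w by simp
  have D1: "y + k *\<^sub>C u \<in> D" for k using u y csubspaceD[OF sub] by blast
  have ah: "0 \<le> a + h" "0 \<le> a - h" using re[OF D1, of \<omega>] re[OF D1, of "- \<omega>"] unfolding p1 p2 by auto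
  have a2: "2 * a \<le> 2 * Re (cinner (T y) y) + \<epsilon>" using uR by (simp add: a_def)
  have Tk: "cinner (T (y + k *\<^sub>C u)) f = cinner (T y) f + k * cinner (T u) f" for k
    using y u csubspaceD(3)[OF sub u] by (simp add: clinear_onD[OF T] cinner_simps)
  \<comment> \<open>\<open>T y\<close> is the average of the images of the two candidates, so one of
    them pairs with \<open>f\<close> at least as strongly as \<open>y\<close> does.\<close>
  have "2 * cmod (cinner (T y) f) = cmod ((cinner (T y) f + \<omega> * cinner (T u) f) + (cinner (T y) f + (- \<omega>) * cinner (T u) f))"
    by (simp flip: mult_2 add: norm_mult)
  also have "\<dots> \<le> cmod (cinner (T y) f + \<omega> * cinner (T u) f) + cmod (cinner (T y) f + (- \<omega>) * cinner (T u) f)"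
    by (rule norm_triangle_ineq)
  finally consider "cmod (cinner (T y) f) \<le> cmod (cinner (T (y + \<omega> *\<^sub>C u)) f)"
    | "cmod (cinner (T y) f) \<le> cmod (cinner (T (y + (- \<omega>) *\<^sub>C u)) f)" unfolding Tk by linarith
  then show ?thesis
  proof cases
    case 1
    then show ?thesis using D1[of \<omega>] ah a2 p1 by (intro bexI[of _ "y + \<omega> *\<^sub>C u"] conjI) (auto simp del: of_real_add)
  next
    case 2
    then show ?thesis using D1[of "-\<omega>"] ah a2 p2 by (intro bexI[of _ "y + (- \<omega>) *\<^sub>C u"] conjI) (auto simp del: of_real_diff scaleC_minus_left)
  qed
qed

subsection \<open>Supporting half-planes\<close>

text \<open>Convexity lets a line separate zero from the numerical range. The last clause serves the
  construction of singular sequences: unbounded coupling is measured against a real part only, and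
  passing from \<open>y\<close> to \<open>y'\<close> keeps the coupling while controlling the whole
  value of the form.\<close>

lemma tilted_form:
  fixes T :: "'a::complex_inner \<Rightarrow> 'a"
  assumes T: "clinear_on D T" and \<delta>: "\<delta> > 0"
    and lower: "\<And>x. x \<in> D \<Longrightarrow> \<delta> * (norm x)\<^sup>2 \<le> cmod (cinner (T x) x)"
  shows "\<exists>\<alpha> b C. \<alpha> \<noteq> 0 \<and> b > 0 \<and> C \<ge> 0 \<and> (\<forall>x\<in>D. b * (norm x)\<^sup>2 \<le> Re (\<alpha> * cinner (T x) x)) \<and>
    (\<forall>y\<in>D. \<forall>f. \<forall>\<epsilon>>0. \<exists>y'\<in>D. cmod (cinner (T y) f) \<le> cmod (cinner (T y') f) \<and>
      cmod (cinner (T y') y') \<le> C * Re (\<alpha> * cinner (T y) y) + \<epsilon>)"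
proof -
  define W where "W = num_range D T"
  have "0 \<notin> closure W"
    unfolding W_def notin_closure_num_range_iff[OF T] using \<delta> lower by auto
  moreover have "convex (closure W)" unfolding W_def by (intro convex_closure convex_num_range[OF T])
  ultimately obtain a b where b: "b > 0" and ab: "\<And>w. w \<in> closure W \<Longrightarrow> inner a w > b"
    using separating_hyperplane_closed_0[of "closure W"] by auto
  \<comment> \<open>\<open>inner a w = Re (cnj a * w)\<close>, so multiplication by
    \<open>cnj a\<close> turns the separating half-plane into a right half-plane.\<close>
  define S where "S x = cnj a *\<^sub>C T x" for x
  have S: "clinear_on D S"
    using T unfolding clinear_on_def S_def by (auto simp: scaleC_add_right scaleC_scaleC mult.commute)
  define q where "q x = cinner (S x) x" for x
  have q: "q x = cnj a * cinner (T x) x" for x by (simp add: q_def S_def cinner_simps)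
  have inner_scale: "inner a (of_real r * z) = r * Re (cnj a * z)" for r z
    by (simp add: inner_complex_def algebra_simps)
  have re: "b * (norm x)\<^sup>2 \<le> Re (q x)" if x: "x \<in> D" for x
  proof (cases "x = 0")
    case False
    have "of_real (1 / (norm x)\<^sup>2) * cinner (T x) x \<in> closure W"
      using subsetD[OF closure_subset num_range_normalize[OF T x False]] by (simp add: W_def)
    from ab[OF this] have "b < 1 / (norm x)\<^sup>2 * Re (q x)"
      unfolding inner_scale q .
    moreover have N: "0 < (norm x)\<^sup>2" using False by simp
    ultimately have "b * (norm x)\<^sup>2 < 1 / (norm x)\<^sup>2 * Re (q x) * (norm x)\<^sup>2"
      by (rule mult_strict_right_mono)
    also have "\<dots> = Re (q x)" using False by simp
    finally show ?thesis by (rule less_imp_le)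
  qed (simp add: q_def)
  have a0: "a \<noteq> 0" if D0: "D \<noteq> {0}"
  proof -
    have "0 \<in> D" by (rule csubspaceD(1)[OF clinear_onD(1)[OF T]])
    then obtain x where x: "x \<in> D" "x \<noteq> 0" using D0 by auto
    then have "b * (norm x)\<^sup>2 > 0" using b by simp
    then show ?thesis using re[OF x(1)] by (auto simp: q)
  qed
  show ?thesis
  proof (cases "D = {0}")
    case True
    then show ?thesis
      by (intro exI[of _ 1] exI[of _ 0]) (use clinear_onD(5)[OF T] in auto)
  next
    case False
    note a0 = a0[OF this]
    have "\<exists>\<beta> b' C. \<beta> \<noteq> 0 \<and> b' > 0 \<and> C \<ge> 0 \<and> (\<forall>x\<in>D. b' * (norm x)\<^sup>2 \<le> Re (\<beta> * q x)) \<and>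
      (\<forall>y\<in>D. \<forall>f. \<forall>\<epsilon>>0. \<exists>y'\<in>D. cmod (cinner (S y) f) \<le> cmod (cinner (S y') f) \<and>
      cmod (q y') \<le> C * Re (\<beta> * q y) + \<epsilon>)" (is ?R)
    proof -
      have sector: ?R if sg: "\<sigma> = 1 \<or> \<sigma> = -1" and \<epsilon>: "\<epsilon> > 0"
        and sec: "\<And>x. x \<in> D \<Longrightarrow> \<sigma> * Im (q x) < 0 \<Longrightarrow> - \<epsilon> * (\<sigma> * Im (q x)) \<le> Re (q x)" for \<sigma> \<epsilon> :: real
      proof -
        from sector_tilt[of \<sigma> b "\<lambda>x. (norm x)\<^sup>2" \<epsilon> D q, OF sg b _ \<epsilon> re sec]
        obtain \<beta> b' C where *: "\<beta> \<noteq> 0" "b' > 0" "C \<ge> 0" "\<forall>x\<in>D. b' * (norm x)\<^sup>2 \<le> Re (\<beta> * q x)"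
          and C: "\<forall>x\<in>D. cmod (q x) \<le> C * Re (\<beta> * q x)" by auto
        have "\<forall>y\<in>D. \<forall>f. \<forall>\<epsilon>>0. \<exists>y'\<in>D. cmod (cinner (S y) f) \<le> cmod (cinner (S y') f) \<and>
          cmod (q y') \<le> C * Re (\<beta> * q y) + \<epsilon>"
        proof (intro ballI allI impI)
          fix y f and e :: real assume "y \<in> D" "e > 0"
          then show "\<exists>y'\<in>D. cmod (cinner (S y) f) \<le> cmod (cinner (S y') f) \<and>
            cmod (q y') \<le> C * Re (\<beta> * q y) + e"
            using C by (intro bexI[of _ y]) (auto intro: add_increasing2)
        qed
        with * show ?R by blast
      qed
      \<comment> \<open>If the upper or the lower boundary direction is avoided,
        \<open>sector\<close> applies with \<open>\<sigma> = -1\<close> or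
        \<open>\<sigma> = 1\<close>, and \<open>y' = y\<close> will do. If both are approached,
        \<open>\<beta> = 1\<close> and the imaginary part is cancelled.\<close>
      show ?R
      proof (cases "\<forall>\<epsilon>>0. \<exists>x\<in>D. 0 < Im (q x) \<and> Re (q x) < \<epsilon> * Im (q x)")
        case False
        then obtain \<epsilon> where "\<epsilon> > 0" "\<And>x. x \<in> D \<Longrightarrow> 0 < Im (q x) \<Longrightarrow> \<epsilon> * Im (q x) \<le> Re (q x)"
          by (meson not_less)
        then show ?R by (intro sector[of "-1" \<epsilon>]) auto
      next
        case pos: True
        show ?R
        proof (cases "\<forall>\<epsilon>>0. \<exists>x\<in>D. Im (q x) < 0 \<and> Re (q x) < \<epsilon> * - Im (q x)")
          case False
          then obtain \<epsilon> where "\<epsilon> > 0" "\<And>x. x \<in> D \<Longrightarrow> Im (q x) < 0 \<Longrightarrow> \<epsilon> * - Im (q x) \<le> Re (q x)"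
            by (meson not_less)
          then show ?R by (intro sector[of 1 \<epsilon>]) auto
        next
          case neg: True
          have re0: "0 \<le> Re (cinner (S x) x)" if "x \<in> D" for x
            using re[OF that] b by (smt (verit) mult_nonneg_nonneg q_def zero_le_power2)
          have "\<forall>y\<in>D. \<forall>f. \<forall>\<epsilon>>0. \<exists>y'\<in>D. cmod (cinner (S y) f) \<le> cmod (cinner (S y') f) \<and>
            cmod (q y') \<le> 2 * Re (1 * q y) + \<epsilon>"
            unfolding q_def mult_1
            by (intro ballI allI impI half_plane_cancel_Im[OF S re0])
               (use pos neg in \<open>auto simp: q_def\<close>)
          moreover have "\<forall>x\<in>D. b * (norm x)\<^sup>2 \<le> Re (1 * q x)" using re by simp
          ultimately show ?R using b by (intro exI[of _ 1] exI[of _ b] exI[of _ 2]) simp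
        qed
      qed
    qed
    then obtain \<beta> b' C where \<beta>: "\<beta> \<noteq> 0" "b' > 0" "C \<ge> 0" and low: "\<forall>x\<in>D. b' * (norm x)\<^sup>2 \<le> Re (\<beta> * q x)"
      and bal: "\<forall>y\<in>D. \<forall>f. \<forall>\<epsilon>>0. \<exists>y'\<in>D. cmod (cinner (S y) f) \<le> cmod (cinner (S y') f) \<and>
        cmod (q y') \<le> C * Re (\<beta> * q y) + \<epsilon>" by blast
    have ca: "cmod a > 0" using a0 by simp
    have "\<exists>y'\<in>D. cmod (cinner (T y) f) \<le> cmod (cinner (T y') f) \<and>
      cmod (cinner (T y') y') \<le> C / cmod a * Re ((\<beta> * cnj a) * cinner (T y) y) + \<epsilon>"
      if y: "y \<in> D" and \<epsilon>: "\<epsilon> > 0" for y f and \<epsilon> :: real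
    proof -
      have "\<epsilon> * cmod a > 0" using \<epsilon> ca by simp
      then obtain y' where y': "y' \<in> D" "cmod (cinner (S y) f) \<le> cmod (cinner (S y') f)"
        "cmod (q y') \<le> C * Re (\<beta> * q y) + \<epsilon> * cmod a" using bal y by blast
      have "cmod (cinner (T y) f) \<le> cmod (cinner (T y') f)"
        using y'(2) ca by (simp add: S_def cinner_simps norm_mult)
      moreover have "cmod a * cmod (cinner (T y') y') \<le> cmod a * (C / cmod a * Re ((\<beta> * cnj a) * cinner (T y) y) + \<epsilon>)"
        using y'(3) ca unfolding q norm_mult by (simp add: distrib_left mult_ac)
      then have "cmod (cinner (T y') y') \<le> C / cmod a * Re ((\<beta> * cnj a) * cinner (T y) y) + \<epsilon>"
        using ca by (simp only: mult_le_cancel_left_pos)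
      ultimately show ?thesis using y'(1) by blast
    qed
    moreover have "\<forall>x\<in>D. b' * (norm x)\<^sup>2 \<le> Re ((\<beta> * cnj a) * cinner (T x) x)"
      using low by (simp add: q mult.assoc)
    moreover have "\<beta> * cnj a \<noteq> 0" "C / cmod a \<ge> 0" using \<beta> a0 by auto
    ultimately show ?thesis using \<beta>(2) by blast
  qed
qed

section \<open>Subsequences, and cross terms of forms with nonnegative real part\<close>

lemma bounded_family_convergent_subseq:
  fixes P :: "nat \<Rightarrow> nat \<Rightarrow> complex"
  assumes "\<And>n j. j < m \<Longrightarrow> cmod (P n j) \<le> B"
  shows "\<exists>r s. strict_mono (r :: nat \<Rightarrow> nat) \<and> (\<forall>j<m. (\<lambda>n. P (r n) j) \<longlonglongrightarrow> s j)"
  using assms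
proof (induction m)
  case 0
  show ?case by (intro exI[of _ id]) (auto simp: strict_mono_def)
next
  case (Suc m)
  have "\<exists>r s. strict_mono (r :: nat \<Rightarrow> nat) \<and> (\<forall>j<m. (\<lambda>n. P (r n) j) \<longlonglongrightarrow> s j)"
    by (rule Suc.IH) (use Suc.prems in auto)
  then obtain r s where r: "strict_mono (r :: nat \<Rightarrow> nat)" and s: "\<And>j. j < m \<Longrightarrow> (\<lambda>n. P (r n) j) \<longlonglongrightarrow> s j"
    by blast
  have "bounded (range (\<lambda>n. P (r n) m))" using Suc.prems[of m] by (auto simp: bounded_iff)
  from bounded_imp_convergent_subsequence[OF this]
  obtain l t where t: "strict_mono (t :: nat \<Rightarrow> nat)" "((\<lambda>n. P (r n) m) \<circ> t) \<longlonglongrightarrow> l" by blast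
  have "(\<lambda>n. P ((r \<circ> t) n) j) \<longlonglongrightarrow> (s(m := l)) j" if "j < Suc m" for j
    using that t(2) LIMSEQ_subseq_LIMSEQ[OF s t(1), of j] by (auto simp: less_Suc_eq o_def)
  then show ?case using strict_mono_o[OF r t(1)] by blast
qed

text \<open>Testing \<open>Re (\<alpha> \<langle>T(w + c y), w + c y\<rangle>) \<ge> 0\<close> with \<open>\<bar>c\<bar> = M\<close> and optimal phase.\<close>

lemma nonneg_form_cross_bound:
  assumes T: "clinear_on D T" and nn: "\<And>x. x \<in> D \<Longrightarrow> 0 \<le> Re (\<alpha> * cinner (T x) x)"
    and w: "w \<in> D" and y: "y \<in> D" and M: "M \<ge> 0"
  shows "M * cmod (\<alpha> * cinner (T y) w) \<le> Re (\<alpha> * cinner (T w) w) + M * (cmod \<alpha> * (norm (T w) * norm y))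
    + M\<^sup>2 * Re (\<alpha> * cinner (T y) y)"
proof -
  define z where "z = \<alpha> * cinner (T y) w"
  \<comment> \<open>The phase opposite to \<open>z\<close>, so that \<open>c * z\<close> is the
    negative real \<open>- M * cmod z\<close>; at \<open>z = 0\<close> any phase serves.\<close>
  define c where "c = (if z = 0 then of_real M else - of_real M * cnj z / of_real (cmod z))"
  have c: "cmod c = M" using M by (simp add: c_def norm_mult norm_divide)
  have cz: "c * z = - of_real (M * cmod z)"
  proof (cases "z = 0")
    case False
    have "c * z = - of_real M * (z * cnj z) / of_real (cmod z)" using False by (simp add: c_def)
    also have "\<dots> = - of_real (M * cmod z)"
      unfolding complex_norm_square[symmetric] using False by (simp add: power2_eq_square)
    finally show ?thesis .
  qed simp
  have R: "Re (of_real r * u) = r * Re u" for r u by simp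
  have "w + c *\<^sub>C y \<in> D" using w y csubspaceD[OF clinear_onD(1)[OF T]] by blast
  from nn[OF this] have "0 \<le> Re (\<alpha> * (cinner (T w) w + c * cinner (T y) w
    + cnj c * cinner (T w) y + of_real (M\<^sup>2) * cinner (T y) y))"
    unfolding quadratic_form_expand[OF T w y] c .
  also have "\<alpha> * (cinner (T w) w + c * cinner (T y) w + cnj c * cinner (T w) y + of_real (M\<^sup>2) * cinner (T y) y)
    = \<alpha> * cinner (T w) w + c * z + \<alpha> * cnj c * cinner (T w) y + of_real (M\<^sup>2) * (\<alpha> * cinner (T y) y)"
    by (simp add: z_def algebra_simps)
  finally have "M * cmod z \<le> Re (\<alpha> * cinner (T w) w) + Re (\<alpha> * cnj c * cinner (T w) y)
    + M\<^sup>2 * Re (\<alpha> * cinner (T y) y)"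
    unfolding cz plus_complex.sel R by simp
  moreover have "Re (\<alpha> * cnj c * cinner (T w) y) \<le> M * (cmod \<alpha> * (norm (T w) * norm y))"
  proof -
    have "Re (\<alpha> * cnj c * cinner (T w) y) \<le> cmod (\<alpha> * cnj c * cinner (T w) y)" by (rule complex_Re_le_cmod)
    also have "\<dots> = (M * cmod \<alpha>) * cmod (cinner (T w) y)" by (simp add: norm_mult c)
    also have "\<dots> \<le> (M * cmod \<alpha>) * (norm (T w) * norm y)"
      using M by (intro mult_left_mono cinner_cauchy_schwarz) auto
    finally show ?thesis by (simp add: mult_ac)
  qed
  ultimately show ?thesis by (simp add: z_def)
qed

text \<open>A Cauchy-Schwarz substitute for a form that need not be Hermitian: divided by
  \<open>M\<close>, \<open>nonneg_form_cross_bound\<close> gives a fixed constant over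
  \<open>M\<close> plus terms that vanish along \<open>y\<close>, and \<open>M\<close> is
  arbitrary.\<close>

lemma nonneg_form_cross_tendsto_zero:
  assumes T: "clinear_on D T" and nn: "\<And>x. x \<in> D \<Longrightarrow> 0 \<le> Re (\<alpha> * cinner (T x) x)" and \<alpha>: "\<alpha> \<noteq> 0"
    and w: "w \<in> D" and y: "\<And>n. y n \<in> D" "y \<longlonglongrightarrow> 0" "(\<lambda>n. cinner (T (y n)) (y n)) \<longlonglongrightarrow> 0"
  shows "(\<lambda>n. cinner (T (y n)) w) \<longlonglongrightarrow> 0"
proof -
  have "(\<lambda>n. cmod (\<alpha> * cinner (T (y n)) w)) \<longlonglongrightarrow> 0"
  proof (rule order_tendstoI)
    fix e :: real assume e: "0 < e"
    define A where "A = Re (\<alpha> * cinner (T w) w)"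
    \<comment> \<open>Makes \<open>M * e = 2 * (A + 1)\<close>, which exceeds the eventual bound
      \<open>A + 1\<close>.\<close>
    define M where "M = 2 * (A + 1) / e"
    have A: "A \<ge> 0" using nn[OF w] by (simp add: A_def)
    then have M: "M > 0" using e by (simp add: M_def)
    have "(\<lambda>n. M * (cmod \<alpha> * (norm (T w) * norm (y n))) + M\<^sup>2 * Re (\<alpha> * cinner (T (y n)) (y n)))
      \<longlonglongrightarrow> M * (cmod \<alpha> * (norm (T w) * norm (0::'a))) + M\<^sup>2 * Re (\<alpha> * 0)"
      by (intro tendsto_intros y)
    then have "eventually (\<lambda>n. M * (cmod \<alpha> * (norm (T w) * norm (y n))) + M\<^sup>2 * Re (\<alpha> * cinner (T (y n)) (y n)) < 1) sequentially"
      by (rule order_tendstoD(2)) simp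
    then show "eventually (\<lambda>n. cmod (\<alpha> * cinner (T (y n)) w) < e) sequentially"
    proof eventually_elim
      case (elim n)
      then have "M * cmod (\<alpha> * cinner (T (y n)) w) < A + 1"
        using nonneg_form_cross_bound[OF T nn w y(1), of M n] M by (simp add: A_def)
      also have "\<dots> < M * e" using A e by (simp add: M_def)
      finally show ?case using M by simp
    qed
  next
    fix e :: real assume "e < 0"
    then show "eventually (\<lambda>n. e < cmod (\<alpha> * cinner (T (y n)) w)) sequentially"
      by (intro always_eventually allI) (rule less_le_trans[OF _ norm_ge_zero])
  qed
  then have "(\<lambda>n. \<alpha> * cinner (T (y n)) w) \<longlonglongrightarrow> 0" by (simp only: tendsto_norm_zero_iff)
  from tendsto_mult[OF tendsto_const[of "1 / \<alpha>"] this] show ?thesis using \<alpha> by simp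
qed

subsection \<open>Finite-rank shifts versus singular sequences\<close>

text \<open>The vector \<open>v\<close> encodes the limit functional on \<open>D\<close>.
  Nonvanishing is asked on \<open>D\<close> itself, since \<open>v \<noteq> 0\<close> would say less
  when \<open>D\<close> is not dense.\<close>

definition singular_seq :: "'a::complex_inner set \<Rightarrow> ('a \<Rightarrow> 'a) \<Rightarrow> (nat \<Rightarrow> 'a) \<Rightarrow> 'a \<Rightarrow> bool" where
  "singular_seq D T y v \<longleftrightarrow> (\<forall>n. y n \<in> D) \<and> y \<longlonglongrightarrow> 0 \<and> (\<lambda>n. cinner (T (y n)) (y n)) \<longlonglongrightarrow> 0 \<and>
    (\<forall>w\<in>D. (\<lambda>n. cinner (T (y n)) w) \<longlonglongrightarrow> cinner v w) \<and> (\<exists>w\<in>D. cinner v w \<noteq> 0)"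

lemma norm_sum_scaleC_le:
  fixes z :: "nat \<Rightarrow> 'a::complex_inner"
  assumes "\<And>j. j < m \<Longrightarrow> norm (z j) \<le> M"
  shows "norm (\<Sum>j<m. \<xi> j *\<^sub>C z j) \<le> (\<Sum>j<m. cmod (\<xi> j)) * M"
proof -
  have "norm (\<Sum>j<m. \<xi> j *\<^sub>C z j) \<le> (\<Sum>j<m. norm (\<xi> j *\<^sub>C z j))" by (rule norm_sum)
  also have "\<dots> \<le> (\<Sum>j<m. cmod (\<xi> j) * M)"
    by (intro sum_mono) (auto simp: norm_scaleC intro!: mult_left_mono assms)
  finally show ?thesis by (simp add: sum_distrib_right)
qed

text \<open>The oblique projection along the \<open>d i\<close>, which splits each vector of
  \<open>D\<close> into a finite-codimensional and a finite-dimensional part.\<close>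

lemma biorthogonal_remainder:
  fixes D :: "'a::complex_inner set" and m :: nat
  assumes D: "csubspace D" and d: "\<And>i. i < m \<Longrightarrow> d i \<in> D"
    and dv: "\<And>i j. i < m \<Longrightarrow> j < m \<Longrightarrow> cinner (d i) (v j) = (if i = j then 1 else 0)"
    and x: "x \<in> D"
  shows "x - (\<Sum>i<m. cinner x (v i) *\<^sub>C d i) \<in> {x\<in>D. \<forall>j<m. cinner x (v j) = 0}"
proof -
  have "cinner (\<Sum>i<m. cinner x (v i) *\<^sub>C d i) (v j) = cinner x (v j)" if "j < m" for j
  proof -
    have "cinner (\<Sum>i<m. cinner x (v i) *\<^sub>C d i) (v j) = (\<Sum>i<m. if i = j then cinner x (v i) else 0)"
      unfolding cinner_sum_left cinner_scaleC_left using that by (intro sum.cong) (auto simp: dv)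
    then show ?thesis using that by simp
  qed
  moreover have "x - (\<Sum>i<m. cinner x (v i) *\<^sub>C d i) \<in> D"
    using d x by (intro csubspaceD(4)[OF D] csubspace_sum[OF D] csubspaceD(3)[OF D]) auto
  ultimately show ?thesis by (simp add: cinner_simps)
qed

text \<open>Split \<open>x = y + g\<close> with \<open>y\<close> in \<open>D0\<close> and
  \<open>g\<close> in the span of the \<open>d j\<close>. Bounded coupling lets half of the form at
  \<open>y\<close> absorb the cross terms. What remains is a deficit quadratic in the coordinates
  \<open>cinner x (v j)\<close>, which a finite-rank operator built from the \<open>v j\<close>
  repays.\<close>

lemma finite_rank_shift_of_bounded_coupling:
  fixes D :: "'a::complex_inner set" and m :: nat
  assumes T: "clinear_on D T" and d: "\<And>i. i < m \<Longrightarrow> d i \<in> D"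
    and dv: "\<And>i j. i < m \<Longrightarrow> j < m \<Longrightarrow> cinner (d i) (v j) = (if i = j then 1 else 0)"
    and \<alpha>: "\<alpha> \<noteq> 0" and b: "b > 0"
    and D0: "D0 = {x\<in>D. \<forall>j<m. cinner x (v j) = 0}"
    and low: "\<And>y. y \<in> D0 \<Longrightarrow> b * (norm y)\<^sup>2 \<le> Re (\<alpha> * cinner (T y) y)"
    and cpl: "\<And>y j. y \<in> D0 \<Longrightarrow> j < m \<Longrightarrow> (cmod (cinner (T y) (d j)))\<^sup>2 \<le> C * Re (\<alpha> * cinner (T y) y)"
  shows "\<exists>K c. cbounded_linear K \<and> finite_rank K \<and> c > 0 \<and>
    (\<forall>x\<in>D. c * (norm x)\<^sup>2 \<le> cmod (cinner (T x + K x) x))"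
proof -
  note sub = clinear_onD(1)[OF T]
  define M where "M = (\<Sum>j<m. norm (d j) + norm (T (d j)))"
  have M0: "M \<ge> 0" unfolding M_def by (intro sum_nonneg) auto
  have Mj: "norm (d j) + norm (T (d j)) \<le> M" if "j < m" for j
    unfolding M_def using that by (intro member_le_sum) auto
  have Md: "norm (d j) \<le> M" "norm (T (d j)) \<le> M" if "j < m" for j
    using Mj[OF that] norm_ge_zero[of "d j"] norm_ge_zero[of "T (d j)"] by linarith+
  define R where "R = sqrt \<bar>C\<bar>"
  \<comment> \<open>Coefficient of \<open>X * s\<close> in the cross terms, with \<open>X\<close>
    the sum of the coordinate moduli and \<open>s\<close> the square root of the form at
    \<open>y\<close>: \<open>R\<close> comes from \<open>cinner (T y) g\<close>,
    \<open>M / sqrt b\<close> from \<open>cinner (T g) y\<close>.\<close>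
  define L1 where "L1 = cmod \<alpha> * (R + M / sqrt b)"
  \<comment> \<open>Collects the multiples of \<open>X\<^sup>2\<close>: from absorbing the cross
    terms, from \<open>cinner (T g) g\<close>, and from the share of \<open>g\<close> in the norm of
    \<open>x\<close>.\<close>
  define L where "L = L1\<^sup>2 / 2 + cmod \<alpha> * M\<^sup>2 + b * M\<^sup>2 / 2"
  have L0: "L \<ge> 0" using b unfolding L_def by simp
  \<comment> \<open>Dividing by \<open>\<alpha>\<close> makes
    \<open>\<alpha> * cinner (K x) x\<close> real and nonnegative; the factor \<open>m\<close> pays
    for bounding the squared sum of moduli by the sum of squares.\<close>
  define K where "K x = (of_real (L * real m) / \<alpha>) *\<^sub>C (\<Sum>j<m. cinner x (v j) *\<^sub>C v j)" for x
  have est: "b / 4 * (norm x)\<^sup>2 - L * (\<Sum>j<m. cmod (cinner x (v j)))\<^sup>2 \<le> Re (\<alpha> * cinner (T x) x)"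
    if x: "x \<in> D" for x
  proof -
    define X where "X = (\<Sum>j<m. cmod (cinner x (v j)))"
    have X0: "X \<ge> 0" unfolding X_def by (intro sum_nonneg) auto
    define g where "g = (\<Sum>j<m. cinner x (v j) *\<^sub>C d j)"
    define y where "y = x - g"
    have y: "y \<in> D0" unfolding y_def g_def D0 by (rule biorthogonal_remainder[OF sub d dv x])
    then have yD: "y \<in> D" unfolding D0 by simp
    have gD: "g \<in> D" unfolding g_def by (intro csubspace_sum[OF sub] csubspaceD(3)[OF sub]) (simp add: d)
    have Tg: "T g = (\<Sum>j<m. cinner x (v j) *\<^sub>C T (d j))"
      unfolding g_def using d csubspaceD(3)[OF sub]
      by (subst clinear_on_sum[OF T]) (auto simp: clinear_onD(3)[OF T])
    have ng: "norm g \<le> X * M" unfolding g_def X_def using Md by (intro norm_sum_scaleC_le) auto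
    have nTg: "norm (T g) \<le> X * M" unfolding Tg X_def using Md by (intro norm_sum_scaleC_le) auto
    define a where "a = Re (\<alpha> * cinner (T y) y)"
    have lowy: "b * (norm y)\<^sup>2 \<le> a" using low[OF y] by (simp add: a_def)
    then have a0: "a \<ge> 0" using b by (meson less_imp_le mult_nonneg_nonneg order_trans zero_le_power2)
    define s where "s = sqrt a"
    have s0: "s \<ge> 0" and ss: "s\<^sup>2 = a" using a0 by (auto simp: s_def)
    have ny: "norm y \<le> s / sqrt b"
    proof -
      have "(norm y)\<^sup>2 \<le> a / b" using lowy b by (simp add: field_simps)
      then have "sqrt ((norm y)\<^sup>2) \<le> sqrt (a / b)" by (rule real_sqrt_le_mono)
      then show ?thesis by (simp add: s_def real_sqrt_divide)
    qed
    have cj: "cmod (cinner (T y) (d j)) \<le> R * s" if "j < m" for j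
    proof -
      have "(cmod (cinner (T y) (d j)))\<^sup>2 \<le> C * a" using cpl[OF y that] by (simp add: a_def)
      also have "\<dots> \<le> \<bar>C\<bar> * a" using a0 by (intro mult_right_mono) auto
      finally have "sqrt ((cmod (cinner (T y) (d j)))\<^sup>2) \<le> sqrt (\<bar>C\<bar> * a)" by (rule real_sqrt_le_mono)
      then show ?thesis by (simp add: s_def R_def real_sqrt_mult)
    qed
    have t1: "cmod (cinner (T y) g) \<le> X * (R * s)"
    proof -
      have "cmod (cinner (T y) g) \<le> (\<Sum>j<m. cmod (cnj (cinner x (v j)) * cinner (T y) (d j)))"
        unfolding g_def cinner_sum_right cinner_scaleC_right by (rule norm_sum)
      also have "\<dots> \<le> (\<Sum>j<m. cmod (cinner x (v j)) * (R * s))"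
        by (intro sum_mono) (auto simp: norm_mult intro!: mult_left_mono cj)
      finally show ?thesis by (simp add: X_def sum_distrib_right)
    qed
    have t2: "cmod (cinner (T g) y) \<le> (X * M) * (s / sqrt b)"
      using cinner_cauchy_schwarz[of "T g" y] mult_mono[OF nTg ny] X0 M0 by force
    have t3: "cmod (cinner (T g) g) \<le> (X * M) * (X * M)"
      using cinner_cauchy_schwarz[of "T g" g] mult_mono[OF nTg ng] X0 M0 by force
    have xyg: "x = y + 1 *\<^sub>C g" by (simp add: y_def)
    have "\<alpha> * cinner (T x) x = \<alpha> * cinner (T y) y + \<alpha> * cinner (T g) y + \<alpha> * cinner (T y) g + \<alpha> * cinner (T g) g"
      unfolding xyg quadratic_form_expand[OF T yD gD] by (simp add: algebra_simps)
    then have "Re (\<alpha> * cinner (T x) x) = a + Re (\<alpha> * cinner (T g) y) + Re (\<alpha> * cinner (T y) g) + Re (\<alpha> * cinner (T g) g)"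
      by (simp only: a_def plus_complex.sel)
    moreover have "- Re (\<alpha> * u) \<le> cmod \<alpha> * B" if "cmod u \<le> B" for u B
    proof -
      have "- Re (\<alpha> * u) \<le> cmod (\<alpha> * u)" using abs_Re_le_cmod[of "\<alpha> * u"] by linarith
      also have "\<dots> \<le> cmod \<alpha> * B" unfolding norm_mult using that by (intro mult_left_mono) auto
      finally show ?thesis .
    qed
    from this[OF t1] this[OF t2] this[OF t3]
    have "- Re (\<alpha> * cinner (T y) g) - Re (\<alpha> * cinner (T g) y) - Re (\<alpha> * cinner (T g) g)
      \<le> cmod \<alpha> * (X * (R * s)) + cmod \<alpha> * ((X * M) * (s / sqrt b)) + cmod \<alpha> * ((X * M) * (X * M))"
      by linarith
    moreover have "cmod \<alpha> * (X * (R * s)) + cmod \<alpha> * ((X * M) * (s / sqrt b)) = (L1 * X) * s"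
      by (simp add: L1_def algebra_simps)
    \<comment> \<open>Young's inequality spends half of \<open>a\<close> here; the other half
      dominates the norm of \<open>x\<close> below.\<close>
    moreover have "(L1 * X) * s \<le> a / 2 + L1\<^sup>2 * X\<^sup>2 / 2"
      using sum_squares_bound[of "L1 * X" s] ss by (simp add: power_mult_distrib)
    ultimately have 1: "a / 2 - (L1\<^sup>2 / 2 + cmod \<alpha> * M\<^sup>2) * X\<^sup>2 \<le> Re (\<alpha> * cinner (T x) x)"
      by (simp add: power2_eq_square algebra_simps)
    have "norm x \<le> norm y + norm g" using norm_triangle_ineq[of y g] by (simp add: y_def)
    then have "(norm x)\<^sup>2 \<le> (norm y + norm g)\<^sup>2" by (simp add: power_mono)
    also have "\<dots> \<le> 2 * (norm y)\<^sup>2 + 2 * (norm g)\<^sup>2"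
      using sum_squares_bound[of "norm y" "norm g"] by (simp add: power2_sum)
    also have "(norm g)\<^sup>2 \<le> (X * M)\<^sup>2" using ng by (simp add: power_mono)
    finally have "(norm x)\<^sup>2 \<le> 2 * (norm y)\<^sup>2 + 2 * (X * M)\<^sup>2" by simp
    then have "b / 4 * (norm x)\<^sup>2 \<le> b / 4 * (2 * (norm y)\<^sup>2 + 2 * (X * M)\<^sup>2)"
      using b by (intro mult_left_mono) auto
    also have "\<dots> \<le> a / 2 + (b * M\<^sup>2 / 2) * X\<^sup>2"
      using lowy by (simp add: algebra_simps power_mult_distrib)
    finally have "b / 4 * (norm x)\<^sup>2 \<le> a / 2 + (b * M\<^sup>2 / 2) * X\<^sup>2" .
    with 1 show ?thesis unfolding X_def[symmetric] L_def by (simp add: algebra_simps)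
  qed
  have "b / 4 / cmod \<alpha> * (norm x)\<^sup>2 \<le> cmod (cinner (T x + K x) x)" if x: "x \<in> D" for x
  proof -
    define S where "S = (\<Sum>j<m. (cmod (cinner x (v j)))\<^sup>2)"
    have "cinner (\<Sum>j<m. cinner x (v j) *\<^sub>C v j) x = of_real S"
      unfolding cinner_sum_left cinner_scaleC_left S_def of_real_sum
      by (intro sum.cong refl) (metis cinner_commute complex_norm_square)
    then have "\<alpha> * cinner (K x) x = of_real (L * real m) * of_real S"
      using \<alpha> by (simp add: K_def cinner_simps)
    then have "\<alpha> * cinner (T x + K x) x = \<alpha> * cinner (T x) x + of_real (L * real m * S)"
      by (simp add: cinner_simps distrib_left)
    then have "Re (\<alpha> * cinner (T x + K x) x) = Re (\<alpha> * cinner (T x) x) + L * real m * S"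
      by (simp only: plus_complex.sel Re_complex_of_real)
    moreover have "(\<Sum>j<m. cmod (cinner x (v j)))\<^sup>2 \<le> S * real m"
      using sum_squared_le_sum_of_squares[of "\<lambda>j. cmod (cinner x (v j))" "{..<m}"] by (simp add: S_def)
    from mult_left_mono[OF this L0]
    have "L * (\<Sum>j<m. cmod (cinner x (v j)))\<^sup>2 \<le> L * real m * S" by (simp add: mult_ac)
    ultimately have "b / 4 * (norm x)\<^sup>2 \<le> Re (\<alpha> * cinner (T x + K x) x)"
      using est[OF x] by linarith
    also have "\<dots> \<le> cmod \<alpha> * cmod (cinner (T x + K x) x)"
      using complex_Re_le_cmod[of "\<alpha> * cinner (T x + K x) x"] by (simp add: norm_mult)
    finally show ?thesis using \<alpha> by (simp add: field_simps)
  qed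
  moreover have "b / 4 / cmod \<alpha> > 0" using b \<alpha> by simp
  moreover have "cbounded_linear K"
    unfolding cbounded_linear_def
  proof
    show "clinear_on UNIV K"
      unfolding clinear_on_def K_def csubspace_def
      by (auto simp: cinner_simps scaleC_add_left sum.distrib scaleC_add_right scaleC_sum_right scaleC_scaleC mult_ac)
    have "norm (K x) \<le> (cmod (of_real (L * real m) / \<alpha>) * (\<Sum>j<m. (norm (v j))\<^sup>2)) * norm x" for x
    proof -
      have "norm (\<Sum>j<m. cinner x (v j) *\<^sub>C v j) \<le> (\<Sum>j<m. norm (cinner x (v j) *\<^sub>C v j))" by (rule norm_sum)
      also have "\<dots> \<le> (\<Sum>j<m. (norm x * norm (v j)) * norm (v j))"
        by (intro sum_mono) (auto simp: norm_scaleC intro!: mult_right_mono cinner_cauchy_schwarz)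
      also have "\<dots> = (\<Sum>j<m. (norm (v j))\<^sup>2) * norm x"
        by (simp add: sum_distrib_left power2_eq_square mult_ac)
      finally have "norm (\<Sum>j<m. cinner x (v j) *\<^sub>C v j) \<le> (\<Sum>j<m. (norm (v j))\<^sup>2) * norm x" .
      then show ?thesis unfolding K_def norm_scaleC mult.assoc by (rule mult_left_mono) simp
    qed
    then show "\<exists>C. \<forall>x. norm (K x) \<le> C * norm x" by blast
  qed
  moreover have "finite_rank K"
    unfolding finite_rank_def
  proof (intro exI conjI)
    show "range K \<subseteq> cspan (v ` {..<m})"
      unfolding K_def using cspan_superset[of "v ` {..<m}"]
      by (auto intro!: csubspaceD(3)[OF csubspace_cspan] csubspace_sum[OF csubspace_cspan])
  qed simp
  ultimately show ?thesis by blast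
qed

text \<open>Failure of every coupling bound supplies vectors with coupling 1 and small real part;
  balancing makes the whole form small. Along a subsequence the couplings to the \<open>d j\<close>
  converge while cross terms with \<open>D0\<close> vanish, and this determines the limit functional
  on all of \<open>D\<close>.\<close>

lemma singular_seq_of_unbounded_coupling:
  fixes D :: "'a::complex_inner set" and m :: nat
  assumes T: "clinear_on D T" and d: "\<And>i. i < m \<Longrightarrow> d i \<in> D"
    and dv: "\<And>i j. i < m \<Longrightarrow> j < m \<Longrightarrow> cinner (d i) (v j) = (if i = j then 1 else 0)"
    and b: "b > 0"
    and D0: "D0 = {x\<in>D. \<forall>j<m. cinner x (v j) = 0}"
    and low: "\<And>y. y \<in> D0 \<Longrightarrow> b * (norm y)\<^sup>2 \<le> Re (\<alpha> * cinner (T y) y)" and C: "C \<ge> 0" and \<alpha>: "\<alpha> \<noteq> 0"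
    and bal: "\<And>y f \<epsilon>. y \<in> D0 \<Longrightarrow> \<epsilon> > 0 \<Longrightarrow> \<exists>y'\<in>D0. cmod (cinner (T y) f) \<le> cmod (cinner (T y') f) \<and>
      cmod (cinner (T y') y') \<le> C * Re (\<alpha> * cinner (T y) y) + \<epsilon>"
    and ncpl: "\<And>B. \<exists>j<m. \<exists>y\<in>D0. (cmod (cinner (T y) (d j)))\<^sup>2 > B * Re (\<alpha> * cinner (T y) y)"
  shows "\<exists>y v. singular_seq D T y v \<and> (\<forall>n. y n \<in> D0)"
proof -
  note sub = clinear_onD(1)[OF T]
  have sub0: "csubspace D0" using sub unfolding D0 csubspace_def by (auto simp: cinner_simps)
  have D0D: "D0 \<subseteq> D" unfolding D0 by blast
  have T0: "clinear_on D0 T" by (rule clinear_on_subset[OF T sub0 D0D])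
  have nn: "0 \<le> Re (\<alpha> * cinner (T y) y)" if "y \<in> D0" for y
    using low[OF that] b by (meson less_imp_le mult_nonneg_nonneg order_trans zero_le_power2)
  have "\<exists>y\<in>D0. cmod (cinner (T y) y) \<le> (C + 1) * (1 / real (Suc n)) \<and> (\<Sum>j<m. cmod (cinner (T y) (d j))) = 1" for n
  proof -
    obtain j y where j: "j < m" and y: "y \<in> D0"
      and big: "(cmod (cinner (T y) (d j)))\<^sup>2 > real (Suc n) * Re (\<alpha> * cinner (T y) y)"
      using ncpl by blast
    define p where "p = cinner (T y) (d j)"
    have "0 \<le> real (Suc n) * Re (\<alpha> * cinner (T y) y)" using nn[OF y] by simp
    then have p0: "cmod p > 0" using big by (auto simp: p_def)
    \<comment> \<open>Normalizes the coupling with \<open>d j\<close> to 1; since \<open>big\<close>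
      compares quadratic quantities, the real part drops to at most
      \<open>1 / real (Suc n)\<close>.\<close>
    define y1 where "y1 = (1 / p) *\<^sub>C y"
    have y1: "y1 \<in> D0" using y csubspaceD(3)[OF sub0] by (simp add: y1_def)
    have y1d: "cinner (T y1) (d j) = 1"
      using p0 by (simp add: y1_def clinear_onD(3)[OF T0 y] cinner_simps p_def)
    have "Re (\<alpha> * cinner (T y1) y1) = Re (of_real ((cmod (1 / p))\<^sup>2) * (\<alpha> * cinner (T y) y))"
      unfolding y1_def quadratic_form_scale[OF T0 y] by (simp add: mult_ac)
    also have "\<dots> = Re (\<alpha> * cinner (T y) y) / (cmod p)\<^sup>2"
      using Re_complex_of_real Im_complex_of_real
      by (simp add: norm_divide power_divide del: of_real_power of_real_divide)
    also have "\<dots> \<le> 1 / real (Suc n)"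
      using big p0 by (simp add: p_def[symmetric] field_simps)
    finally have a1: "Re (\<alpha> * cinner (T y1) y1) \<le> 1 / real (Suc n)" .
    have "1 / real (Suc n) > 0" by simp
    from bal[OF y1 this, of "d j"] obtain y2 where y2: "y2 \<in> D0" "1 \<le> cmod (cinner (T y2) (d j))"
      "cmod (cinner (T y2) y2) \<le> C * Re (\<alpha> * cinner (T y1) y1) + 1 / real (Suc n)"
      by (auto simp: y1d)
    define S where "S = (\<Sum>j<m. cmod (cinner (T y2) (d j)))"
    have "cmod (cinner (T y2) (d j)) \<le> S" unfolding S_def using j by (intro member_le_sum) auto
    then have S1: "S \<ge> 1" using y2(2) by simp
    \<comment> \<open>Fixing the total coupling at 1 keeps the limit functional from vanishing; as
      \<open>S \<ge> 1\<close>, the form only shrinks.\<close>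
    define y3 where "y3 = of_real (1 / S) *\<^sub>C y2"
    have cS: "cmod (of_real (1 / S)) = 1 / S" using S1 by (simp only: norm_of_real) simp
    have "cmod (cinner (T y3) y3) = (1 / S)\<^sup>2 * cmod (cinner (T y2) y2)"
      unfolding y3_def quadratic_form_scale[OF T0 y2(1)] cS by (simp add: norm_mult norm_divide norm_power power_divide)
    also have "\<dots> \<le> 1 * cmod (cinner (T y2) y2)"
      using S1 by (intro mult_right_mono power_le_one) auto
    also have "\<dots> \<le> C * (1 / real (Suc n)) + 1 / real (Suc n)"
      using y2(3) mult_left_mono[OF a1 C] by linarith
    finally have "cmod (cinner (T y3) y3) \<le> (C + 1) * (1 / real (Suc n))" by (simp only: distrib_right mult_1)
    moreover have "(\<Sum>j<m. cmod (cinner (T y3) (d j))) = (1 / S) * S"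
      by (simp only: y3_def clinear_onD(3)[OF T0 y2(1)] cinner_scaleC_left norm_mult cS
        sum_distrib_left[symmetric] S_def[symmetric])
    moreover have "y3 \<in> D0" unfolding y3_def by (rule csubspaceD(3)[OF sub0 y2(1)])
    ultimately show ?thesis using S1 by (intro bexI[of _ y3] conjI) auto
  qed
  then obtain Y where Y: "\<And>n. Y n \<in> D0" and qY: "\<And>n. cmod (cinner (T (Y n)) (Y n)) \<le> (C + 1) * (1 / real (Suc n))"
    and sY: "\<And>n. (\<Sum>j<m. cmod (cinner (T (Y n)) (d j))) = 1" by metis
  have bd: "cmod (cinner (T (Y n)) (d j)) \<le> 1" if "j < m" for n j
    unfolding sY[of n, symmetric] using that by (intro member_le_sum) auto
  obtain r s where r: "strict_mono (r :: nat \<Rightarrow> nat)"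
    and s: "\<And>j. j < m \<Longrightarrow> (\<lambda>n. cinner (T (Y (r n))) (d j)) \<longlonglongrightarrow> s j"
    using bounded_family_convergent_subseq[where P = "\<lambda>n j. cinner (T (Y n)) (d j)", OF bd] by blast
  define y where "y n = Y (r n)" for n
  have yD0: "y n \<in> D0" for n by (simp add: y_def Y)
  have "(\<lambda>n. (C + 1) * (1 / real (Suc n))) \<longlonglongrightarrow> (C + 1) * 0"
    by (intro tendsto_intros LIMSEQ_inverse_real_of_nat[unfolded inverse_eq_divide])
  then have "(\<lambda>n. (C + 1) * (1 / real (Suc n))) \<longlonglongrightarrow> 0" by simp
  then have "(\<lambda>n. cinner (T (Y n)) (Y n)) \<longlonglongrightarrow> 0"
    by (rule Lim_null_comparison[rotated]) (simp only: qY eventually_True)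
  from LIMSEQ_subseq_LIMSEQ[OF this r] have qy: "(\<lambda>n. cinner (T (y n)) (y n)) \<longlonglongrightarrow> 0"
    by (simp add: o_def y_def)
  have "(\<lambda>n. Re (\<alpha> * cinner (T (y n)) (y n)) / b) \<longlonglongrightarrow> Re (\<alpha> * 0) / b"
    by (intro tendsto_intros qy) (use b in auto)
  then have "(\<lambda>n. Re (\<alpha> * cinner (T (y n)) (y n)) / b) \<longlonglongrightarrow> 0" by simp
  then have "(\<lambda>n. (norm (y n))\<^sup>2) \<longlonglongrightarrow> 0"
  proof (rule Lim_null_comparison[rotated])
    have "norm ((norm (y n))\<^sup>2) \<le> Re (\<alpha> * cinner (T (y n)) (y n)) / b" for n
    proof -
      have "(norm (y n))\<^sup>2 * b \<le> Re (\<alpha> * cinner (T (y n)) (y n))"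
        using low[OF yD0[of n]] by (simp only: mult.commute)
      then show ?thesis using b by (simp only: pos_le_divide_eq) simp
    qed
    then show "\<forall>\<^sub>F n in sequentially. norm ((norm (y n))\<^sup>2) \<le> Re (\<alpha> * cinner (T (y n)) (y n)) / b"
      by (simp only: eventually_True)
  qed
  then have y0: "y \<longlonglongrightarrow> 0"
    using tendsto_real_sqrt[of "\<lambda>n. (norm (y n))\<^sup>2" 0] by (simp add: tendsto_norm_zero_iff)
  \<comment> \<open>The \<open>v j\<close> annihilate \<open>D0\<close> and are dual to the
    \<open>d j\<close>, so this vector induces the functional that is zero on \<open>D0\<close> and
    equals \<open>s j\<close> at \<open>d j\<close>.\<close>
  define w where "w = (\<Sum>j<m. s j *\<^sub>C v j)"
  have lim: "(\<lambda>n. cinner (T (y n)) x) \<longlonglongrightarrow> cinner w x" if x: "x \<in> D" for x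
  proof -
    define x0 where "x0 = x - (\<Sum>j<m. cinner x (v j) *\<^sub>C d j)"
    have "x0 \<in> D0" unfolding x0_def D0 by (rule biorthogonal_remainder[OF sub d dv x])
    then have 0: "(\<lambda>n. cinner (T (y n)) x0) \<longlonglongrightarrow> 0"
      using nonneg_form_cross_tendsto_zero[OF T0 nn \<alpha> _ yD0 y0 qy] by blast
    have "(\<lambda>n. cinner (T (y n)) x0 + (\<Sum>j<m. cnj (cinner x (v j)) * cinner (T (y n)) (d j)))
      \<longlonglongrightarrow> 0 + (\<Sum>j<m. cnj (cinner x (v j)) * s j)"
      using s by (intro tendsto_add 0 tendsto_sum tendsto_mult tendsto_const) (auto simp: y_def)
    moreover have "cinner (T (y n)) x = cinner (T (y n)) x0 + (\<Sum>j<m. cnj (cinner x (v j)) * cinner (T (y n)) (d j))" for n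
      by (simp add: x0_def cinner_simps cinner_sum_right)
    moreover have "cinner w x = (\<Sum>j<m. cnj (cinner x (v j)) * s j)"
      unfolding w_def cinner_sum_left cinner_scaleC_left
      by (intro sum.cong refl) (metis cinner_commute mult.commute)
    ultimately show ?thesis by simp
  qed
  have wd: "cinner w (d j) = s j" if "j < m" for j
    using LIMSEQ_unique[OF lim[OF d[OF that]]] s[OF that] by (simp add: y_def)
  have "(\<lambda>n. \<Sum>j<m. cmod (cinner (T (Y (r n))) (d j))) \<longlonglongrightarrow> (\<Sum>j<m. cmod (s j))"
    using s by (intro tendsto_sum tendsto_norm) auto
  then have "(\<Sum>j<m. cmod (s j)) = 1" by (simp add: sY LIMSEQ_const_iff)
  then have "\<exists>j<m. s j \<noteq> 0" by (metis (no_types, lifting) lessThan_iff norm_zero sum.neutral zero_neq_one)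
  then have "\<exists>x\<in>D. cinner w x \<noteq> 0" using wd d by metis
  then have "singular_seq D T y w"
    unfolding singular_seq_def using yD0 D0D y0 qy lim by blast
  then show ?thesis using yD0 by blast
qed

text \<open>The couplings between \<open>D0\<close> and its finite complement are bounded by the
  form or they are not; each case feeds one of the two preceding constructions. Orthogonality of the
  singular vectors to \<open>F\<close> matters where near-orthogonality to finitely many vectors is
  prescribed.\<close>

lemma finite_rank_shift_or_singular_seq:
  fixes D :: "'a::complex_inner set"
  assumes T: "clinear_on D T" and F: "finite F" and \<delta>: "\<delta> > 0"
    and low: "\<And>x. x \<in> D \<Longrightarrow> \<forall>u\<in>F. cinner x u = 0 \<Longrightarrow> \<delta> * (norm x)\<^sup>2 \<le> cmod (cinner (T x) x)"
  obtains K c where "cbounded_linear K" "finite_rank K" "c > 0"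
      "\<And>x. x \<in> D \<Longrightarrow> c * (norm x)\<^sup>2 \<le> cmod (cinner (T x + K x) x)"
    | y v where "singular_seq D T y v" "\<And>n u. u \<in> F \<Longrightarrow> cinner (y n) u = 0"
proof -
  note sub = clinear_onD(1)[OF T]
  obtain m :: nat and v d where d: "\<And>i. i < m \<Longrightarrow> d i \<in> D"
    and dv: "\<And>i j. i < m \<Longrightarrow> j < m \<Longrightarrow> cinner (d i) (v j) = (if i = j then 1 else 0)"
    and eq: "{x\<in>D. \<forall>j<m. cinner x (v j) = 0} = {x\<in>D. \<forall>u\<in>F. cinner x u = 0}"
    using biorthogonal_system[OF sub F] by blast
  define D0 where "D0 = {x\<in>D. \<forall>j<m. cinner x (v j) = 0}"
  have D0F: "D0 = {x\<in>D. \<forall>u\<in>F. cinner x u = 0}" by (simp add: D0_def eq)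
  have sub0: "csubspace D0" using sub unfolding D0_def csubspace_def by (auto simp: cinner_simps)
  have T0: "clinear_on D0 T" by (rule clinear_on_subset[OF T sub0]) (auto simp: D0_def)
  have "\<delta> * (norm x)\<^sup>2 \<le> cmod (cinner (T x) x)" if "x \<in> D0" for x
    using that low unfolding D0F by blast
  from tilted_form[OF T0 \<delta> this] obtain \<alpha> b C where \<alpha>: "\<alpha> \<noteq> 0" and b: "b > 0" and C: "C \<ge> 0"
    and lw: "\<And>x. x \<in> D0 \<Longrightarrow> b * (norm x)\<^sup>2 \<le> Re (\<alpha> * cinner (T x) x)"
    and bal: "\<And>y f \<epsilon>. y \<in> D0 \<Longrightarrow> \<epsilon> > 0 \<Longrightarrow> \<exists>y'\<in>D0. cmod (cinner (T y) f) \<le> cmod (cinner (T y') f) \<and>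
      cmod (cinner (T y') y') \<le> C * Re (\<alpha> * cinner (T y) y) + \<epsilon>" by blast
  show thesis
  proof (cases "\<exists>B. \<forall>j<m. \<forall>y\<in>D0. (cmod (cinner (T y) (d j)))\<^sup>2 \<le> B * Re (\<alpha> * cinner (T y) y)")
    case True
    then obtain B where "\<And>y j. y \<in> D0 \<Longrightarrow> j < m \<Longrightarrow> (cmod (cinner (T y) (d j)))\<^sup>2 \<le> B * Re (\<alpha> * cinner (T y) y)"
      by blast
    from finite_rank_shift_of_bounded_coupling[OF T d dv \<alpha> b D0_def lw this] show thesis
      using that(1) by blast
  next
    case False
    then have "\<And>B. \<exists>j<m. \<exists>y\<in>D0. (cmod (cinner (T y) (d j)))\<^sup>2 > B * Re (\<alpha> * cinner (T y) y)"
      by (meson not_less)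
    from singular_seq_of_unbounded_coupling[OF T d dv b D0_def lw C \<alpha> bal this] show thesis
      using that(2) unfolding D0F by blast
  qed
qed

subsection \<open>The inclusions between the essential numerical ranges\<close>

lemma clinear_on_shift: "clinear_on D T \<Longrightarrow> clinear_on D (\<lambda>x. T x - l *\<^sub>C x)"
  unfolding clinear_on_def by (auto simp: scaleC_add_right scaleC_diff_right scaleC_scaleC mult.commute)

lemma clinear_on_add: "clinear_on D T \<Longrightarrow> cbounded_linear K \<Longrightarrow> clinear_on D (\<lambda>x. T x + K x)"
  unfolding clinear_on_def cbounded_linear_def by (auto simp: scaleC_add_right)

lemma cinner_shift: "cinner (T x - l *\<^sub>C x) x = cinner (T x) x - l * of_real ((norm x)\<^sup>2)"
  by (simp add: cinner_simps cinner_self)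

lemma dense_not_orthogonal:
  assumes "closure S = (UNIV :: 'a::complex_inner set)" "v \<noteq> 0"
  shows "\<exists>w\<in>S. cinner v w \<noteq> 0"
proof (rule ccontr)
  assume "\<not> ?thesis"
  then have *: "\<And>w. w \<in> S \<Longrightarrow> cinner v w = 0" by blast
  have "v \<in> closure S" using assms(1) by simp
  then obtain s where s: "\<And>n. s n \<in> S" "s \<longlonglongrightarrow> v" unfolding closure_sequential by blast
  have "(\<lambda>n. cinner v (s n)) \<longlonglongrightarrow> cinner v v" by (intro tendsto_cinner tendsto_const s)
  then have "cinner v v = 0" using * s(1) by (simp add: LIMSEQ_const_iff)
  then show False using assms(2) by (simp add: cinner_eq_zero_iff)
qed

text \<open>Of the terms carrying \<open>y n\<close>, only \<open>\<mu> * cinner (T (y n)) w\<close>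
  survives in the limit. Since \<open>\<mu>\<close> is free, the form can be steered to any complex
  value as soon as \<open>cinner v w \<noteq> 0\<close>.\<close>

lemma singular_seq_perturb_tendsto:
  assumes T: "clinear_on D T" and y: "singular_seq D T y v" and w: "w \<in> D"
  shows "(\<lambda>n. cinner (T (w + \<mu> *\<^sub>C y n)) (w + \<mu> *\<^sub>C y n)) \<longlonglongrightarrow> cinner (T w) w + \<mu> * cinner v w"
    and "(\<lambda>n. w + \<mu> *\<^sub>C y n) \<longlonglongrightarrow> w" and "w + \<mu> *\<^sub>C y n \<in> D"
proof -
  have yD: "y n \<in> D" for n using y by (simp add: singular_seq_def)
  have y0: "y \<longlonglongrightarrow> 0" and qy: "(\<lambda>n. cinner (T (y n)) (y n)) \<longlonglongrightarrow> 0"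
    and yw: "(\<lambda>n. cinner (T (y n)) w) \<longlonglongrightarrow> cinner v w"
    using y w by (auto simp: singular_seq_def)
  have "(\<lambda>n. cinner (T w) w + \<mu> * cinner (T (y n)) w + cnj \<mu> * cinner (T w) (y n)
    + of_real ((cmod \<mu>)\<^sup>2) * cinner (T (y n)) (y n))
    \<longlonglongrightarrow> cinner (T w) w + \<mu> * cinner v w + cnj \<mu> * cinner (T w) 0 + of_real ((cmod \<mu>)\<^sup>2) * 0"
    by (intro tendsto_intros tendsto_cinner yw y0 qy)
  then show "(\<lambda>n. cinner (T (w + \<mu> *\<^sub>C y n)) (w + \<mu> *\<^sub>C y n)) \<longlonglongrightarrow> cinner (T w) w + \<mu> * cinner v w"
    by (simp add: quadratic_form_expand[OF T w yD])
  have "(\<lambda>n. w + \<mu> *\<^sub>C y n) \<longlonglongrightarrow> w + \<mu> *\<^sub>C 0" by (intro tendsto_add tendsto_scaleC tendsto_const y0)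
  then show "(\<lambda>n. w + \<mu> *\<^sub>C y n) \<longlonglongrightarrow> w" by simp
  show "w + \<mu> *\<^sub>C y n \<in> D" using w yD[of n] csubspaceD[OF clinear_onD(1)[OF T]] by blast
qed

text \<open>Dependent choice on finite prefixes: as \<open>good k\<close> sees only the entries
  below \<open>k\<close> and each stage overwrites only entry \<open>k\<close>, the stages stabilize
  to one sequence.\<close>

lemma sequence_extension:
  fixes good :: "nat \<Rightarrow> (nat \<Rightarrow> 'b) \<Rightarrow> bool"
  assumes base: "good 0 e0"
    and step: "\<And>k e. good k e \<Longrightarrow> \<exists>u. good (Suc k) (e(k := u))"
    and cong: "\<And>k e e'. (\<And>i. i < k \<Longrightarrow> e i = e' i) \<Longrightarrow> good k e \<Longrightarrow> good k e'"
  shows "\<exists>e. \<forall>k. good k e"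
proof -
  have "\<exists>F. \<forall>n. good n (F n) \<and> (\<exists>u. F (Suc n) = (F n)(n := u))"
    by (rule dependent_nat_choice) (use base step in blast)+
  then obtain F where F: "\<And>n. good n (F n)" and ext: "\<And>n. \<exists>u. F (Suc n) = (F n)(n := u)" by blast
  have stable: "F (n + m) i = F n i" if "i < n" for n m i
  proof (induction m)
    case (Suc m)
    obtain u where "F (Suc (n + m)) = (F (n + m))(n + m := u)" using ext by blast
    then show ?case using Suc that by simp
  qed simp
  \<comment> \<open>Entry \<open>i\<close> is written on passing to stage \<open>Suc i\<close> and
    never changes afterwards.\<close>
  have "good k (\<lambda>i. F (Suc i) i)" for k
  proof (rule cong[OF _ F[of k]])
    fix i assume "i < k"
    then obtain m where "k = Suc i + m" using less_imp_Suc_add by (metis add_Suc)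
    then show "F k i = F (Suc i) i" using stable[of i "Suc i" m] by simp
  qed
  then show ?thesis by blast
qed

lemma We4I:
  assumes "\<And>k. orthonormal k e" "\<And>i. e i \<in> D"
    and q: "\<And>i. cmod (cinner (T (e i)) (e i) - l) < 1 / real (Suc i)"
  shows "l \<in> We4 D T"
proof -
  have "(\<lambda>i. cinner (T (e i)) (e i) - l) \<longlonglongrightarrow> 0"
    by (rule Lim_null_comparison[OF _ LIMSEQ_inverse_real_of_nat])
       (use q in \<open>auto simp: inverse_eq_divide intro!: always_eventually less_imp_le\<close>)
  then have "(\<lambda>i. cinner (T (e i)) (e i)) \<longlonglongrightarrow> l" by (simp only: LIM_zero_iff)
  moreover have "cinner (e m) (e n) = (if m = n then 1 else 0)" for m n
    using assms(1)[of "Suc (max m n)"] by (simp add: orthonormal_def)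
  ultimately show ?thesis unfolding We4_def using assms(2) by blast
qed

text \<open>Intersecting over all \<open>V\<close> allows the next vector to be taken orthogonal to
  the span of those already chosen, with its form value as close to \<open>l\<close> as
  desired.\<close>

lemma We1_subset_We4:
  fixes D :: "'a::complex_inner set"
  shows "We1 D T \<subseteq> We4 D T"
proof
  fix l assume l: "l \<in> We1 D T"
  define good where "good k e \<longleftrightarrow> orthonormal k e \<and>
    (\<forall>i<k. e i \<in> D \<and> cmod (cinner (T (e i)) (e i) - l) < 1 / real (Suc i))" for k and e :: "nat \<Rightarrow> 'a"
  have "\<exists>e. \<forall>k. good k e"
  proof (rule sequence_extension)
    show "good 0 (\<lambda>_. 0)" by (simp add: good_def orthonormal_def)
    show "\<exists>u. good (Suc k) (e(k := u))" if g: "good k e" for k e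
    proof -
      have "finite_dim_csubspace (cspan (e ` {..<k}))"
        unfolding finite_dim_csubspace_def using csubspace_cspan by blast
      then have "l \<in> closure (num_range (orth_compl (cspan (e ` {..<k})) \<inter> D) T)"
        using l unfolding We1_def by blast
      moreover have "1 / real (Suc k) > 0" by simp
      ultimately obtain w where "w \<in> num_range (orth_compl (cspan (e ` {..<k})) \<inter> D) T"
        and w: "dist w l < 1 / real (Suc k)" unfolding closure_approachable by blast
      then obtain u where u: "u \<in> orth_compl (e ` {..<k})" "u \<in> D" "norm u = 1" "w = cinner (T u) u"
        unfolding num_range_def orth_compl_cspan by blast
      have "orthonormal (Suc k) (e(k := u))"
        using g u by (intro orthonormal_append) (auto simp: good_def orth_compl_def)
      then have "good (Suc k) (e(k := u))" using g u w by (auto simp: good_def less_Suc_eq dist_norm)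
      then show ?thesis by blast
    qed
    show "good k e'" if "\<And>i. i < k \<Longrightarrow> e i = e' i" "good k e" for k and e e' :: "nat \<Rightarrow> 'a"
      using that by (simp add: good_def orthonormal_def)
  qed
  then obtain e where e: "\<And>k. good k e" by blast
  then show "l \<in> We4 D T" by (intro We4I[of e]) (use e lessI in \<open>auto simp: good_def\<close>)
qed

lemma We4_subset_ess_num_range: "We4 D T \<subseteq> ess_num_range D T"
proof
  fix l assume "l \<in> We4 D T"
  then obtain e where e: "\<And>n. e n \<in> D" and o: "\<And>m n. cinner (e m) (e n) = (if m = n then 1 else 0)"
    and l: "(\<lambda>n. cinner (T (e n)) (e n)) \<longlonglongrightarrow> l" unfolding We4_def by blast
  have "weak_conv e 0" by (rule orthonormal_weak_conv_zero) (simp add: orthonormal_def o)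
  moreover have "norm (e n) = 1" for n by (simp add: norm_eq_sqrt_cinner o)
  ultimately show "l \<in> ess_num_range D T" unfolding ess_num_range_def using e l by blast
qed

text \<open>A compact operator sends weakly null unit vectors to a norm-null sequence, so adding it
  does not change the limit of the form.\<close>

lemma ess_num_range_subset_We3:
  fixes D :: "'h::chilbert_space set"
  shows "ess_num_range D T \<subseteq> We3 D T"
proof
  fix l assume "l \<in> ess_num_range D T"
  then obtain x where x: "\<And>n. x n \<in> D" "\<And>n. norm (x n) = 1" "weak_conv x 0"
    and l: "(\<lambda>n. cinner (T (x n)) (x n)) \<longlonglongrightarrow> l" unfolding ess_num_range_def by blast
  have "l \<in> closure (num_range D (\<lambda>x. T x + K x))" if K: "cbounded_linear K" "compact_op K" for K
  proof -
    have "(\<lambda>n. norm (K (x n))) \<longlonglongrightarrow> 0"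
      using compact_op_weak_null[OF K x(3,2)] by (rule tendsto_norm_zero)
    then have "(\<lambda>n. cinner (K (x n)) (x n)) \<longlonglongrightarrow> 0"
    proof (rule Lim_null_comparison[rotated])
      have "cmod (cinner (K (x n)) (x n)) \<le> norm (K (x n))" for n
        using cinner_cauchy_schwarz[of "K (x n)" "x n"] x(2) by simp
      then show "\<forall>\<^sub>F n in sequentially. cmod (cinner (K (x n)) (x n)) \<le> norm (K (x n))" by simp
    qed
    from tendsto_add[OF l this] have "(\<lambda>n. cinner (T (x n) + K (x n)) (x n)) \<longlonglongrightarrow> l"
      by (simp add: cinner_add_left)
    moreover have "cinner (T (x n) + K (x n)) (x n) \<in> num_range D (\<lambda>x. T x + K x)" for n
      unfolding num_range_def using x(1,2)[of n] by blast
    ultimately show ?thesis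
      unfolding closure_sequential by (intro exI[of _ "\<lambda>n. cinner (T (x n) + K (x n)) (x n)"]) simp
  qed
  then show "l \<in> We3 D T" unfolding We3_def by blast
qed

lemma We3_subset_We2: "We3 D T \<subseteq> We2 D T"
  unfolding We2_def We3_def using finite_rank_imp_compact_op by blast

lemma notin_We2I:
  assumes T: "clinear_on D T" and K: "cbounded_linear K" "finite_rank K" and c: "c > 0"
    and low: "\<And>x. x \<in> D \<Longrightarrow> c * (norm x)\<^sup>2 \<le> cmod (cinner (T x - l *\<^sub>C x + K x) x)"
  shows "l \<notin> We2 D T"
proof -
  have "l \<notin> closure (num_range D (\<lambda>x. T x + K x))"
    unfolding notin_closure_num_range_iff[OF clinear_on_add[OF T K(1)]]
    using c low by (intro exI[of _ c]) (simp add: cinner_simps cinner_self algebra_simps)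
  then show ?thesis unfolding We2_def using K by blast
qed

text \<open>Of the two alternatives for \<open>T\<close> shifted by \<open>l\<close>, the
  finite-rank one would exclude \<open>l\<close> from \<open>We2\<close>, so the singular sequence
  remains.\<close>

lemma singular_seq_of_notin_We1:
  assumes T: "clinear_on D T" and 1: "l \<notin> We1 D T" and 2: "l \<in> We2 D T"
  shows "\<exists>y v. singular_seq D (\<lambda>x. T x - l *\<^sub>C x) y v"
proof -
  obtain V where V: "finite_dim_csubspace V" and l: "l \<notin> closure (num_range (orth_compl V \<inter> D) T)"
    using 1 unfolding We1_def by blast
  obtain F where F: "finite F" "V = cspan F" using V unfolding finite_dim_csubspace_def by blast
  have "clinear_on (orth_compl V \<inter> D) T"
    by (rule clinear_on_subset[OF T csubspace_Int[OF csubspace_orth_compl clinear_onD(1)[OF T]]]) simp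
  from l[unfolded notin_closure_num_range_iff[OF this]]
  obtain \<delta> where "\<delta> > 0" and d: "\<And>x. x \<in> D \<Longrightarrow> x \<in> orth_compl F \<Longrightarrow>
      \<delta> * (norm x)\<^sup>2 \<le> cmod (cinner (T x) x - l * of_real ((norm x)\<^sup>2))"
    unfolding F(2) orth_compl_cspan by blast
  show ?thesis
  proof (rule finite_rank_shift_or_singular_seq[OF clinear_on_shift[OF T, of l] F(1) \<open>\<delta> > 0\<close>])
    show "\<delta> * (norm x)\<^sup>2 \<le> cmod (cinner (T x - l *\<^sub>C x) x)" if "x \<in> D" "\<forall>u\<in>F. cinner x u = 0" for x
      unfolding cinner_shift using d[OF that(1)] that(2) by (simp add: orth_compl_def)
  next
    fix K c assume "cbounded_linear K" "finite_rank K" "c > (0::real)"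
      "\<And>x. x \<in> D \<Longrightarrow> c * (norm x)\<^sup>2 \<le> cmod (cinner (T x - l *\<^sub>C x + K x) x)"
    then have "l \<notin> We2 D T" by (rule notin_We2I[OF T])
    then show ?thesis using 2 by simp
  next
    fix y v assume "singular_seq D (\<lambda>x. T x - l *\<^sub>C x) y v"
    then show ?thesis by blast
  qed
qed

text \<open>Outside the essential numerical range, the shifted form is bounded below even on a cone
  of vectors nearly orthogonal to finitely many members of a dense sequence. The finite-rank
  alternative contradicts membership in \<open>We2\<close>; a singular sequence would drive the form
  to zero inside the cone.\<close>

lemma We2_subset_ess_num_range:
  fixes D :: "'a::complex_inner set"
  assumes separable: "\<exists>S. countable S \<and> closure S = (UNIV :: 'a set)" and T: "clinear_on D T"
  shows "We2 D T \<subseteq> ess_num_range D T"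
proof (rule subsetI, rule ccontr)
  fix l assume l2: "l \<in> We2 D T" and l: "l \<notin> ess_num_range D T"
  note sub = clinear_onD(1)[OF T]
  define Tl where "Tl = (\<lambda>x. T x - l *\<^sub>C x)"
  have Tl: "clinear_on D Tl" unfolding Tl_def by (rule clinear_on_shift[OF T])
  obtain S where S: "countable S" "closure S = (UNIV :: 'a set)" using separable by blast
  then have Sne: "S \<noteq> {}" by auto
  define s where "s = from_nat_into S"
  have rs: "range s = S" unfolding s_def using S(1) Sne by (simp add: range_from_nat_into)
  \<comment> \<open>Were this false for every \<open>n\<close>, the normalized counterexamples would
    be asymptotically orthogonal to each \<open>s i\<close>, hence weakly null by density and
    boundedness, with form tending to zero: \<open>l\<close> would be an essential value.\<close>
  have "\<exists>n. \<forall>x\<in>D. (\<forall>i<n. cmod (cinner x (s i)) \<le> norm x / real (Suc n)) \<longrightarrow>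
    (norm x)\<^sup>2 / real (Suc n) \<le> cmod (cinner (Tl x) x)"
  proof (rule ccontr)
    assume "\<not> ?thesis"
    then have "\<forall>n. \<exists>x\<in>D. (\<forall>i<n. cmod (cinner x (s i)) \<le> norm x / real (Suc n)) \<and>
      cmod (cinner (Tl x) x) < (norm x)\<^sup>2 / real (Suc n)" by (meson not_less)
    then obtain x where xD: "\<And>n. x n \<in> D"
      and xs: "\<And>n i. i < n \<Longrightarrow> cmod (cinner (x n) (s i)) \<le> norm (x n) / real (Suc n)"
      and xq: "\<And>n. cmod (cinner (Tl (x n)) (x n)) < (norm (x n))\<^sup>2 / real (Suc n)" by metis
    have x0: "norm (x n) > 0" for n
    proof (rule ccontr)
      assume "\<not> 0 < norm (x n)"
      then have "norm (x n) = 0" by simp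
      then have "cmod (cinner (Tl (x n)) (x n)) < 0" using xq[of n] by simp
      then show False using norm_ge_zero[of "cinner (Tl (x n)) (x n)"] by linarith
    qed
    define u where "u n = of_real (1 / norm (x n)) *\<^sub>C x n" for n
    have cx: "cmod (of_real (1 / norm (x n))) = 1 / norm (x n)" for n by (simp only: norm_of_real) simp
    have un: "norm (u n) = 1" for n unfolding u_def norm_scaleC cx using x0[of n] by simp
    have uD: "u n \<in> D" for n unfolding u_def by (intro csubspaceD(3)[OF sub] xD)
    have us: "cmod (cinner (u n) (s i)) \<le> 1 / real (Suc n)" if "i < n" for n i
    proof -
      have "cmod (cinner (u n) (s i)) = 1 / norm (x n) * cmod (cinner (x n) (s i))"
        unfolding u_def cinner_scaleC_left norm_mult cx ..
      also have "\<dots> \<le> 1 / norm (x n) * (norm (x n) / real (Suc n))"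
        by (intro mult_left_mono xs that) simp
      finally show ?thesis using x0[of n] by simp
    qed
    have uq: "cmod (cinner (Tl (u n)) (u n)) \<le> 1 / real (Suc n)" for n
    proof -
      have "cmod (cinner (Tl (u n)) (u n)) = (1 / norm (x n))\<^sup>2 * cmod (cinner (Tl (x n)) (x n))"
        unfolding u_def quadratic_form_scale[OF Tl xD] cx norm_mult by (simp only: norm_of_real) simp
      also have "\<dots> \<le> (1 / norm (x n))\<^sup>2 * ((norm (x n))\<^sup>2 / real (Suc n))"
        by (intro mult_left_mono less_imp_le[OF xq]) simp
      finally show ?thesis using x0[of n] by (simp add: power_divide)
    qed
    have "weak_conv u 0"
      unfolding weak_conv_def
    proof
      fix y
      have "(\<lambda>n. cinner (u n) y) \<longlonglongrightarrow> 0"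
      proof (rule LIMSEQ_I)
        fix e :: real assume e: "0 < e"
        have "y \<in> closure S" using S(2) by simp
        then obtain z where "z \<in> S" "dist z y < e / 2" unfolding closure_approachable using e
          by (meson half_gt_zero)
        then obtain i where i: "norm (y - s i) < e / 2" using rs by (auto simp: dist_norm norm_minus_commute)
        obtain N where N: "1 / real (Suc N) < e / 2" using e nat_approx_posE half_gt_zero by blast
        have "norm (cinner (u n) y - 0) < e" if n: "n \<ge> max N (Suc i)" for n
        proof -
          have "cinner (u n) y = cinner (u n) (s i) + cinner (u n) (y - s i)" by (simp add: cinner_simps)
          then have "cmod (cinner (u n) y) \<le> cmod (cinner (u n) (s i)) + cmod (cinner (u n) (y - s i))"
            by (simp only: norm_triangle_ineq)
          also have "cmod (cinner (u n) (s i)) \<le> 1 / real (Suc n)" using n by (intro us) auto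
          also have "1 / real (Suc n) \<le> 1 / real (Suc N)" using n by (simp add: frac_le)
          also have "cmod (cinner (u n) (y - s i)) \<le> norm (y - s i)"
            using cinner_cauchy_schwarz[of "u n" "y - s i"] un by simp
          finally show ?thesis using N i by simp
        qed
        then show "\<exists>N. \<forall>n\<ge>N. norm (cinner (u n) y - 0) < e" by blast
      qed
      then show "(\<lambda>n. cinner (u n) y) \<longlonglongrightarrow> cinner 0 y" by simp
    qed
    moreover have "(\<lambda>n. cinner (Tl (u n)) (u n)) \<longlonglongrightarrow> 0"
      by (rule Lim_null_comparison[OF _ LIMSEQ_inverse_real_of_nat])
         (use uq in \<open>auto simp: inverse_eq_divide\<close>)
    then have "(\<lambda>n. cinner (T (u n)) (u n) - l) \<longlonglongrightarrow> 0"
      by (simp add: Tl_def cinner_shift un)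
    then have "(\<lambda>n. cinner (T (u n)) (u n)) \<longlonglongrightarrow> l" by (simp only: LIM_zero_iff)
    ultimately have "l \<in> ess_num_range D T" unfolding ess_num_range_def using uD un by blast
    then show False using l by simp
  qed
  then obtain n where cone: "\<And>x. x \<in> D \<Longrightarrow> \<forall>i<n. cmod (cinner x (s i)) \<le> norm x / real (Suc n) \<Longrightarrow>
    (norm x)\<^sup>2 / real (Suc n) \<le> cmod (cinner (Tl x) x)" by blast
  have n0: "1 / real (Suc n) > 0" by simp
  show False
  proof (rule finite_rank_shift_or_singular_seq[OF Tl _ n0, of "s ` {..<n}"])
    show "1 / real (Suc n) * (norm x)\<^sup>2 \<le> cmod (cinner (Tl x) x)"
      if "x \<in> D" "\<forall>u\<in>s ` {..<n}. cinner x u = 0" for x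
      using cone[OF that(1)] that(2) by simp
  next
    fix K c assume "cbounded_linear K" "finite_rank K" "c > (0::real)"
      "\<And>x. x \<in> D \<Longrightarrow> c * (norm x)\<^sup>2 \<le> cmod (cinner (Tl x + K x) x)"
    then have "l \<notin> We2 D T" unfolding Tl_def by (rule notin_We2I[OF T])
    then show False using l2 by simp
  next
    fix y v assume y: "singular_seq D Tl y v" and ys: "\<And>k u. u \<in> s ` {..<n} \<Longrightarrow> cinner (y k) u = 0"
    obtain w where w: "w \<in> D" "cinner v w \<noteq> 0" using y by (auto simp: singular_seq_def)
    have yD: "y k \<in> D" for k using y by (simp add: singular_seq_def)
    have "\<exists>k. y k \<noteq> 0"
    proof (rule ccontr)
      assume "\<not> ?thesis"
      then have "cinner (Tl (y k)) w = 0" for k using clinear_onD(5)[OF Tl] by simp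
      moreover have "(\<lambda>k. cinner (Tl (y k)) w) \<longlonglongrightarrow> cinner v w" using y w by (simp add: singular_seq_def)
      ultimately show False using w(2) by (simp add: LIMSEQ_const_iff)
    qed
    then obtain k where k: "y k \<noteq> 0" by blast
    define z where "z = y k"
    have z: "z \<in> D" "norm z > 0" "\<And>i. i < n \<Longrightarrow> cinner z (s i) = 0"
      using k yD ys by (auto simp: z_def)
    \<comment> \<open>\<open>z\<close> is exactly orthogonal to the \<open>s i\<close>, hence inside
      the open cone; if \<open>v\<close> annihilates it, a small multiple of \<open>w\<close> is
      added. Strictness leaves room for the perturbation that follows.\<close>
    have "\<exists>X\<in>D. norm X > 0 \<and> (\<forall>i<n. cmod (cinner X (s i)) < norm X / real (Suc n)) \<and> cinner v X \<noteq> 0"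
    proof (cases "cinner v z = 0")
      case False
      then show ?thesis using z by (intro bexI[of _ z]) auto
    next
      case True
      define X where "X j = z + of_real (inverse (real (Suc j))) *\<^sub>C w" for j
      have XD: "X j \<in> D" for j unfolding X_def using z w csubspaceD[OF sub] by blast
      have "X \<longlonglongrightarrow> z + of_real 0 *\<^sub>C w"
        unfolding X_def by (intro tendsto_add tendsto_const tendsto_scaleC tendsto_of_real LIMSEQ_inverse_real_of_nat)
      then have X: "X \<longlonglongrightarrow> z" by simp
      have "(\<lambda>j. norm (X j) / real (Suc n) - cmod (cinner (X j) (s i))) \<longlonglongrightarrow> norm z / real (Suc n) - cmod (cinner z (s i))" for i
        by (intro tendsto_intros tendsto_cinner X) simp
      then have "eventually (\<lambda>j. 0 < norm (X j) / real (Suc n) - cmod (cinner (X j) (s i))) sequentially" if "i < n" for i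
        by (rule order_tendstoD(1)) (use z(2) z(3)[OF that] in simp)
      then have "eventually (\<lambda>j. \<forall>i\<in>{..<n}. 0 < norm (X j) / real (Suc n) - cmod (cinner (X j) (s i))) sequentially"
        by (intro eventually_ball_finite) auto
      moreover have "eventually (\<lambda>j. 0 < norm (X j)) sequentially"
        using order_tendstoD(1)[OF tendsto_norm[OF X] z(2)] .
      ultimately have "eventually (\<lambda>j. (\<forall>i\<in>{..<n}. 0 < norm (X j) / real (Suc n) - cmod (cinner (X j) (s i))) \<and> 0 < norm (X j)) sequentially"
        by (rule eventually_conj)
      then obtain j where j: "\<forall>i\<in>{..<n}. 0 < norm (X j) / real (Suc n) - cmod (cinner (X j) (s i))" "0 < norm (X j)"
        by (auto simp: eventually_sequentially)
      have "cinner v (X j) = of_real (inverse (real (Suc j))) * cinner v w"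
        using True by (simp add: X_def cinner_simps)
      then have "cinner v (X j) \<noteq> 0" using w(2) by (simp del: of_nat_Suc)
      then show ?thesis using j XD by (intro bexI[of _ "X j"]) auto
    qed
    then obtain X where X: "X \<in> D" "norm X > 0" "cinner v X \<noteq> 0"
      and Xs: "\<And>i. i < n \<Longrightarrow> cmod (cinner X (s i)) < norm X / real (Suc n)" by blast
    \<comment> \<open>Chosen so that the limit \<open>cinner (Tl X) X + \<mu> * cinner v X\<close>
      is zero.\<close>
    define \<mu> where "\<mu> = - (cinner (Tl X) X / cinner v X)"
    define x where "x j = X + \<mu> *\<^sub>C y j" for j
    note lim = singular_seq_perturb_tendsto[OF Tl y X(1), of \<mu>, folded x_def]
    have q: "(\<lambda>j. cinner (Tl (x j)) (x j)) \<longlonglongrightarrow> 0" using lim(1) X(3) by (simp add: \<mu>_def)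
    have xX: "x \<longlonglongrightarrow> X" using lim(2) .
    have "(\<lambda>j. norm (x j) / real (Suc n) - cmod (cinner (x j) (s i))) \<longlonglongrightarrow> norm X / real (Suc n) - cmod (cinner X (s i))" for i
      by (intro tendsto_intros tendsto_cinner xX) simp
    then have "eventually (\<lambda>j. 0 < norm (x j) / real (Suc n) - cmod (cinner (x j) (s i))) sequentially" if "i < n" for i
      by (rule order_tendstoD(1)) (use Xs[OF that] in simp)
    then have "eventually (\<lambda>j. \<forall>i\<in>{..<n}. 0 < norm (x j) / real (Suc n) - cmod (cinner (x j) (s i))) sequentially"
      by (intro eventually_ball_finite) auto
    moreover have "(\<lambda>j. (norm (x j))\<^sup>2 / real (Suc n) - cmod (cinner (Tl (x j)) (x j))) \<longlonglongrightarrow> (norm X)\<^sup>2 / real (Suc n) - cmod 0"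
      by (intro tendsto_intros xX q) simp
    then have "eventually (\<lambda>j. 0 < (norm (x j))\<^sup>2 / real (Suc n) - cmod (cinner (Tl (x j)) (x j))) sequentially"
      by (rule order_tendstoD(1)) (use X(2) in simp)
    ultimately have "eventually (\<lambda>j. (\<forall>i\<in>{..<n}. 0 < norm (x j) / real (Suc n) - cmod (cinner (x j) (s i))) \<and>
       0 < (norm (x j))\<^sup>2 / real (Suc n) - cmod (cinner (Tl (x j)) (x j))) sequentially"
      by (rule eventually_conj)
    then obtain j where j: "\<And>i. i < n \<Longrightarrow> 0 < norm (x j) / real (Suc n) - cmod (cinner (x j) (s i))"
       "0 < (norm (x j))\<^sup>2 / real (Suc n) - cmod (cinner (Tl (x j)) (x j))"
      by (auto simp: eventually_sequentially)
    have "\<forall>i<n. cmod (cinner (x j) (s i)) \<le> norm (x j) / real (Suc n)" using j(1) by (force intro: less_imp_le)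
    from cone[OF lim(3) this] show False using j(2) by simp
  qed simp
qed

section \<open>Orthonormal sequences over a dense domain\<close>

lemma tendsto_proj:
  assumes "(f \<longlongrightarrow> a) F"
  shows "((\<lambda>n. proj k e (f n)) \<longlongrightarrow> proj k e a) F"
  unfolding proj_def by (intro tendsto_sum tendsto_scaleC tendsto_cinner tendsto_const assms)

text \<open>The subtracted projections lie in a fixed finite-dimensional subspace of
  \<open>D\<close> with coefficients tending to zero, so they and their images tend to zero in norm,
  even if \<open>T\<close> is unbounded.\<close>

lemma singular_seq_orthogonalize:
  assumes T: "clinear_on D T" and y: "singular_seq D T y v"
    and e: "orthonormal k e" "\<And>i. i < k \<Longrightarrow> e i \<in> D"
  shows "singular_seq D T (\<lambda>n. y n - proj k e (y n)) v"
proof -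
  note sub = clinear_onD(1)[OF T]
  have yD: "y n \<in> D" for n using y by (simp add: singular_seq_def)
  have y0: "y \<longlonglongrightarrow> 0" and qy: "(\<lambda>n. cinner (T (y n)) (y n)) \<longlonglongrightarrow> 0"
    and yw: "\<And>w. w \<in> D \<Longrightarrow> (\<lambda>n. cinner (T (y n)) w) \<longlonglongrightarrow> cinner v w"
    and ex: "\<exists>w\<in>D. cinner v w \<noteq> 0" using y by (auto simp: singular_seq_def)
  define p where "p n = proj k e (y n)" for n
  have pD: "p n \<in> D" for n unfolding p_def using e(2) by (intro csubspace_proj[OF sub])
  have "p \<longlonglongrightarrow> proj k e 0" unfolding p_def by (rule tendsto_proj[OF y0])
  then have p0: "p \<longlonglongrightarrow> 0" by (simp add: proj_def)
  have c0: "(\<lambda>n. cinner (y n) (e i)) \<longlonglongrightarrow> 0" for i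
    using tendsto_cinner[OF y0 tendsto_const[of "e i"]] by simp
  have Tp: "T (p n) = (\<Sum>i<k. cinner (y n) (e i) *\<^sub>C T (e i))" for n
    unfolding p_def proj_def using e(2) csubspaceD(3)[OF sub]
    by (subst clinear_on_sum[OF T]) (auto simp: clinear_onD(3)[OF T])
  have "(\<lambda>n. T (p n)) \<longlonglongrightarrow> (\<Sum>i<k. 0 *\<^sub>C T (e i))"
    unfolding Tp by (intro tendsto_sum tendsto_scaleC tendsto_const c0)
  then have Tp0: "(\<lambda>n. T (p n)) \<longlonglongrightarrow> 0" by simp
  have "(\<lambda>n. \<Sum>i<k. cnj (cinner (y n) (e i)) * cinner (T (y n)) (e i)) \<longlonglongrightarrow> (\<Sum>i<k. cnj 0 * cinner v (e i))"
    using e(2) by (intro tendsto_sum tendsto_mult tendsto_cnj c0 yw) auto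
  then have Typ: "(\<lambda>n. cinner (T (y n)) (p n)) \<longlonglongrightarrow> 0"
    by (simp add: p_def proj_def cinner_sum_right cinner_scaleC_right)
  have "(\<lambda>n. cinner (T (y n)) (y n) - cinner (T (y n)) (p n) - cinner (T (p n)) (y n) + cinner (T (p n)) (p n))
    \<longlonglongrightarrow> 0 - 0 - cinner (0::'a) 0 + cinner (0::'a) 0"
    by (intro tendsto_add tendsto_diff qy Typ tendsto_cinner Tp0 y0 p0)
  then have "(\<lambda>n. cinner (T (y n - p n)) (y n - p n)) \<longlonglongrightarrow> 0"
    using yD pD by (simp add: clinear_onD(4)[OF T] cinner_simps algebra_simps)
  moreover have "(\<lambda>n. cinner (T (y n - p n)) w) \<longlonglongrightarrow> cinner v w" if "w \<in> D" for w
  proof -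
    have "(\<lambda>n. cinner (T (y n)) w - cinner (T (p n)) w) \<longlonglongrightarrow> cinner v w - cinner 0 w"
      by (intro tendsto_diff yw[OF that] tendsto_cinner Tp0 tendsto_const)
    then show ?thesis using yD pD by (simp add: clinear_onD(4)[OF T] cinner_simps)
  qed
  moreover have "(\<lambda>n. y n - p n) \<longlonglongrightarrow> 0" using tendsto_diff[OF y0 p0] by simp
  moreover have "y n - p n \<in> D" for n by (intro csubspaceD(4)[OF sub] yD pD)
  ultimately show ?thesis using ex unfolding singular_seq_def p_def by blast
qed

lemma cinner_eq_zero_commute: "cinner x y = 0 \<longleftrightarrow> cinner y (x::'a::complex_inner) = 0"
  using cinner_commute[of x y] by auto

lemma exists_orthogonal_nonzero:
  fixes e :: "nat \<Rightarrow> 'a::complex_inner"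
  assumes inf: "\<not> (\<exists>F. finite F \<and> cspan F = (UNIV :: 'a set))" and e: "orthonormal k e"
  shows "\<exists>u. u \<noteq> 0 \<and> (\<forall>i<k. cinner u (e i) = 0)"
proof -
  have "\<exists>x. x \<noteq> proj k e x"
  proof (rule ccontr)
    assume "\<not> ?thesis"
    then have *: "proj k e x = x" for x by metis
    have "proj k e x \<in> cspan (e ` {..<k})" for x
      using cspan_superset[of "e ` {..<k}"] by (intro csubspace_proj[OF csubspace_cspan]) auto
    then have "cspan (e ` {..<k}) = UNIV" using * by auto
    then show False using inf by blast
  qed
  then obtain x where "x \<noteq> proj k e x" by blast
  then show ?thesis
    using cinner_proj[OF e, of _ x] by (intro exI[of _ "x - proj k e x"]) (simp add: cinner_simps)
qed

text \<open>The invariant \<open>v \<notin> span {e i | i < k}\<close> is what allows the construction to continue: it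
  guarantees vectors \<open>w \<in> D\<close> orthogonal to all \<open>e i\<close> with \<open>\<langle>v, w\<rangle> \<noteq> 0\<close>, and adding a multiple of a
  late member of the singular sequence then moves \<open>\<langle>Tw, w\<rangle>\<close> to 0 while hardly changing \<open>w\<close>.\<close>

lemma singular_seq_orthonormal_step:
  fixes D :: "'a::complex_inner set"
  assumes inf: "\<not> (\<exists>F. finite F \<and> cspan F = (UNIV :: 'a set))" and dense: "closure D = UNIV"
    and T: "clinear_on D T" and y: "singular_seq D T y v"
    and e: "orthonormal k e" "\<And>i. i < k \<Longrightarrow> e i \<in> D" and v: "v \<noteq> proj k e v" and \<epsilon>: "\<epsilon> > 0"
  shows "\<exists>u\<in>D. norm u = 1 \<and> (\<forall>i<k. cinner u (e i) = 0) \<and> cmod (cinner (T u) u) < \<epsilon> \<and>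
    v \<noteq> proj (Suc k) (e(k := u)) v"
proof -
  note sub = clinear_onD(1)[OF T]
  define v' where "v' = v - proj k e v"
  have v'0: "v' \<noteq> 0" using v by (simp add: v'_def)
  have v'e: "cinner v' (e i) = 0" if "i < k" for i
    using cinner_proj[OF e(1) that, of v] by (simp add: v'_def cinner_simps)
  define g where "g = (1 / of_real (norm v')) *\<^sub>C v'"
  have "norm g = 1" using v'0 by (simp add: g_def norm_scaleC norm_divide)
  moreover have "cinner g (e i) = 0" if "i < k" for i using v'e[OF that] by (simp add: g_def cinner_simps)
  ultimately have "orthonormal (Suc k) (e(k := g))" using e(1) by (intro orthonormal_append)
  \<comment> \<open>\<open>h\<close> is orthogonal to \<open>v'\<close> and acts as a witness: a new
    vector with \<open>cinner h u \<noteq> 0\<close> cannot be parallel to \<open>v'\<close>, so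
    \<open>v\<close> stays outside the enlarged span.\<close>
  from exists_orthogonal_nonzero[OF inf this] obtain h where h0: "h \<noteq> 0"
    and h: "\<And>i. i < Suc k \<Longrightarrow> cinner h ((e(k := g)) i) = 0" by blast
  have he: "cinner h (e i) = 0" if "i < k" for i using h[of i] that by simp
  have "cinner h g = 0" using h[of k] by simp
  then have hv: "cinner h v' = 0" using v'0 by (simp add: g_def cinner_simps)
  then have vh: "cinner v' h = 0" using cinner_eq_zero_commute by blast
  \<comment> \<open>This target pairs nontrivially with both \<open>v'\<close> and \<open>h\<close>;
    so do nearby vectors of \<open>D\<close>, also after removing their components along the
    \<open>e i\<close>.\<close>
  have "v' + h \<in> closure D" using dense by simp
  then obtain x where xD: "\<And>n. x n \<in> D" and x: "x \<longlonglongrightarrow> v' + h" unfolding closure_sequential by blast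
  define w where "w n = x n - proj k e (x n)" for n
  have "w \<longlonglongrightarrow> (v' + h) - proj k e (v' + h)" unfolding w_def by (intro tendsto_diff tendsto_proj x)
  moreover have "proj k e (v' + h) = 0" unfolding proj_def by (simp add: cinner_simps v'e he)
  ultimately have w: "w \<longlonglongrightarrow> v' + h" by simp
  have "(\<lambda>n. cinner v' (w n)) \<longlonglongrightarrow> cinner v' (v' + h)" "(\<lambda>n. cinner h (w n)) \<longlonglongrightarrow> cinner h (v' + h)"
    by (intro tendsto_cinner tendsto_const w)+
  moreover have "cinner v' (v' + h) \<noteq> 0" "cinner h (v' + h) \<noteq> 0"
    using v'0 h0 by (simp_all add: cinner_simps hv vh cinner_eq_zero_iff)
  ultimately have "eventually (\<lambda>n. cinner v' (w n) \<noteq> 0) sequentially" "eventually (\<lambda>n. cinner h (w n) \<noteq> 0) sequentially"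
    using tendsto_imp_eventually_ne by blast+
  then have "eventually (\<lambda>n. cinner v' (w n) \<noteq> 0 \<and> cinner h (w n) \<noteq> 0) sequentially" by (rule eventually_conj)
  then obtain n where n: "cinner v' (w n) \<noteq> 0" "cinner h (w n) \<noteq> 0" by (auto simp: eventually_sequentially)
  define a where "a = w n"
  have aD: "a \<in> D" unfolding a_def w_def using e(2) by (intro csubspaceD(4)[OF sub] csubspace_proj[OF sub] xD)
  have ae: "cinner a (e i) = 0" if "i < k" for i
    using cinner_proj[OF e(1) that, of "x n"] by (simp add: a_def w_def cinner_simps)
  have pa: "cinner (proj k e v) a = 0"
    unfolding proj_def cinner_sum_left cinner_scaleC_left
    by (intro sum.neutral ballI) (use ae cinner_eq_zero_commute in auto)
  then have va: "cinner v a \<noteq> 0" using n(1) by (simp add: v'_def a_def[symmetric] cinner_simps)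
  have ha: "cinner h a \<noteq> 0" using n(2) by (simp add: a_def)
  then have a0: "norm a > 0" by auto
  define y' where "y' n = y n - proj k e (y n)" for n
  have y': "singular_seq D T y' v" unfolding y'_def by (rule singular_seq_orthogonalize[OF T y e])
  have y'e: "cinner (y' n) (e i) = 0" if "i < k" for i n
    using cinner_proj[OF e(1) that, of "y n"] by (simp add: y'_def cinner_simps)
  define \<mu> where "\<mu> = - (cinner (T a) a / cinner v a)"
  define b where "b n = a + \<mu> *\<^sub>C y' n" for n
  note lim = singular_seq_perturb_tendsto[OF T y' aD, of \<mu>, folded b_def]
  have q: "(\<lambda>n. cinner (T (b n)) (b n)) \<longlonglongrightarrow> 0" using lim(1) va by (simp add: \<mu>_def)
  have "(\<lambda>n. cinner h (b n)) \<longlonglongrightarrow> cinner h a" by (intro tendsto_cinner tendsto_const lim(2))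
  then have 1: "eventually (\<lambda>n. cinner h (b n) \<noteq> 0) sequentially" using ha by (rule tendsto_imp_eventually_ne)
  have "(\<lambda>n. \<epsilon> * (norm (b n))\<^sup>2 - cmod (cinner (T (b n)) (b n))) \<longlonglongrightarrow> \<epsilon> * (norm a)\<^sup>2 - cmod 0"
    by (intro tendsto_intros lim(2) q)
  then have 2: "eventually (\<lambda>n. 0 < \<epsilon> * (norm (b n))\<^sup>2 - cmod (cinner (T (b n)) (b n))) sequentially"
    by (rule order_tendstoD(1)) (use a0 \<epsilon> in simp)
  from eventually_conj[OF 1 2] obtain m where hb: "cinner h (b m) \<noteq> 0"
    and qb: "0 < \<epsilon> * (norm (b m))\<^sup>2 - cmod (cinner (T (b m)) (b m))" by (auto simp: eventually_sequentially)
  have b0: "norm (b m) > 0" using hb by auto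
  define c where "c = complex_of_real (1 / norm (b m))"
  have c: "cmod c = 1 / norm (b m)" unfolding c_def by (simp only: norm_of_real) simp
  define u where "u = c *\<^sub>C b m"
  have uD: "u \<in> D" unfolding u_def by (intro csubspaceD(3)[OF sub] lim(3))
  have nu: "norm u = 1" unfolding u_def norm_scaleC c using b0 by simp
  have ue: "cinner u (e i) = 0" if "i < k" for i
    using ae[OF that] y'e[OF that] by (simp add: u_def b_def cinner_simps)
  have "cmod (cinner (T u) u) = (1 / norm (b m))\<^sup>2 * cmod (cinner (T (b m)) (b m))"
    unfolding u_def quadratic_form_scale[OF T lim(3)] c norm_mult by (simp only: norm_of_real) simp
  also have "\<dots> < (1 / norm (b m))\<^sup>2 * (\<epsilon> * (norm (b m))\<^sup>2)"
    using qb b0 by (intro mult_strict_left_mono) auto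
  also have "\<dots> = \<epsilon>" using b0 by (simp add: power_divide)
  finally have qu: "cmod (cinner (T u) u) < \<epsilon>" .
  have "c \<noteq> 0" using b0 by (simp add: c_def)
  then have hu: "cinner h u \<noteq> 0" using hb by (simp add: u_def cinner_simps)
  have "v \<noteq> proj (Suc k) (e(k := u)) v"
  proof
    assume "v = proj (Suc k) (e(k := u)) v"
    then have eq: "v' = cinner v u *\<^sub>C u" unfolding proj_append v'_def by (simp add: algebra_simps)
    have "cinner h v' = cnj (cinner v u) * cinner h u" unfolding eq by (simp add: cinner_simps)
    then have "cinner v u = 0" using hv hu by simp
    then show False using eq v'0 by simp
  qed
  then show ?thesis using uD nu ue qu by blast
qed

text \<open>Points of \<open>We1\<close> are already covered. For any other point, the singular
  sequence of the shifted operator drives an inductive choice of orthonormal vectors with form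
  values approaching \<open>l\<close>.\<close>

lemma We2_subset_We4:
  fixes D :: "'a::complex_inner set"
  assumes inf: "\<not> (\<exists>F. finite F \<and> cspan F = (UNIV :: 'a set))" and dense: "closure D = UNIV"
    and T: "clinear_on D T"
  shows "We2 D T \<subseteq> We4 D T"
proof
  fix l assume l2: "l \<in> We2 D T"
  show "l \<in> We4 D T"
  proof (cases "l \<in> We1 D T")
    case True
    then show ?thesis using We1_subset_We4 by blast
  next
    case False
    define Tl where "Tl = (\<lambda>x. T x - l *\<^sub>C x)"
    have Tl: "clinear_on D Tl" unfolding Tl_def by (rule clinear_on_shift[OF T])
    obtain y v where y: "singular_seq D Tl y v"
      using singular_seq_of_notin_We1[OF T False l2] unfolding Tl_def by blast
    have v0: "v \<noteq> 0" using y by (auto simp: singular_seq_def)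
    define good where "good k e \<longleftrightarrow> orthonormal k e \<and> v \<noteq> proj k e v \<and>
      (\<forall>i<k. e i \<in> D \<and> cmod (cinner (Tl (e i)) (e i)) < 1 / real (Suc i))" for k and e :: "nat \<Rightarrow> 'a"
    have "\<exists>e. \<forall>k. good k e"
    proof (rule sequence_extension)
      show "good 0 (\<lambda>_. 0)" using v0 by (simp add: good_def orthonormal_def proj_def)
      show "\<exists>u. good (Suc k) (e(k := u))" if g: "good k e" for k e
      proof -
        have "1 / real (Suc k) > 0" by simp
        with g have "\<exists>u\<in>D. norm u = 1 \<and> (\<forall>i<k. cinner u (e i) = 0) \<and> cmod (cinner (Tl u) u) < 1 / real (Suc k) \<and>
          v \<noteq> proj (Suc k) (e(k := u)) v"
          by (intro singular_seq_orthonormal_step[OF inf dense Tl y]) (auto simp: good_def)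
        then obtain u where u: "u \<in> D" "norm u = 1" "\<And>i. i < k \<Longrightarrow> cinner u (e i) = 0"
          "cmod (cinner (Tl u) u) < 1 / real (Suc k)" "v \<noteq> proj (Suc k) (e(k := u)) v" by blast
        have "orthonormal (Suc k) (e(k := u))"
          using g u by (intro orthonormal_append) (auto simp: good_def)
        then have "good (Suc k) (e(k := u))" using g u unfolding good_def by (simp add: less_Suc_eq)
        then show ?thesis by blast
      qed
      show "good k e'" if eq: "\<And>i. i < k \<Longrightarrow> e i = e' i" and g: "good k e" for k and e e' :: "nat \<Rightarrow> 'a"
      proof -
        have "proj k e' v = proj k e v" unfolding proj_def using eq by (intro sum.cong) auto
        then show ?thesis using g eq by (simp add: good_def orthonormal_def)
      qed
    qed
    then obtain e where e: "\<And>k. good k e" by blast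
    show ?thesis
    proof (rule We4I)
      show o: "orthonormal k e" for k using e[of k] by (simp add: good_def)
      show eD: "e i \<in> D" for i using e[of "Suc i"] by (simp add: good_def)
      have n1: "norm (e i) = 1" for i using o[of "Suc i"] by (simp add: orthonormal_def norm_eq_sqrt_cinner)
      have "cmod (cinner (Tl (e i)) (e i)) < 1 / real (Suc i)" for i
        using e[of "Suc i"] by (simp add: good_def)
      then show "cmod (cinner (T (e i)) (e i) - l) < 1 / real (Suc i)" for i
        unfolding Tl_def cinner_shift n1 by simp
    qed
  qed
qed

section \<open>What a singular sequence implies for the numerical range and the adjoint\<close>

text \<open>Steering the form along the singular sequence makes the numerical range dense in the
  plane, and a dense convex subset of the plane is the whole plane.\<close>

lemma num_range_UNIV_of_singular_seq:
  assumes T: "clinear_on D T" and y: "singular_seq D (\<lambda>x. T x - l *\<^sub>C x) y v"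
  shows "num_range D T = UNIV"
proof -
  define Tl where "Tl = (\<lambda>x. T x - l *\<^sub>C x)"
  have Tl: "clinear_on D Tl" unfolding Tl_def by (rule clinear_on_shift[OF T])
  note y = y[folded Tl_def]
  obtain w where w: "w \<in> D" "cinner v w \<noteq> 0" using y by (auto simp: singular_seq_def)
  have w0: "norm w > 0" using w(2) by auto
  have "c \<in> closure (num_range D T)" for c
  proof -
    \<comment> \<open>Makes the shifted form tend to \<open>c - l\<close> times the squared norm of
      \<open>w\<close>, so that the normalized values of \<open>T\<close> tend to
      \<open>c\<close>.\<close>
    define \<mu> where "\<mu> = ((c - l) * of_real ((norm w)\<^sup>2) - cinner (Tl w) w) / cinner v w"
    define b where "b n = w + \<mu> *\<^sub>C y n" for n
    note lim = singular_seq_perturb_tendsto[OF Tl y w(1), of \<mu>, folded b_def]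
    have "(\<lambda>n. cinner (Tl (b n)) (b n)) \<longlonglongrightarrow> (c - l) * of_real ((norm w)\<^sup>2)"
      using lim(1) w(2) by (simp add: \<mu>_def)
    then have "(\<lambda>n. cinner (Tl (b n)) (b n) / of_real ((norm (b n))\<^sup>2) + l)
      \<longlonglongrightarrow> (c - l) * of_real ((norm w)\<^sup>2) / of_real ((norm w)\<^sup>2) + l"
      by (intro tendsto_intros lim(2)) (use w0 in auto)
    then have t: "(\<lambda>n. cinner (Tl (b n)) (b n) / of_real ((norm (b n))\<^sup>2) + l) \<longlonglongrightarrow> c"
      using w0 by simp
    have "eventually (\<lambda>n. b n \<noteq> 0) sequentially"
      by (rule tendsto_imp_eventually_ne[OF lim(2)]) (use w0 in auto)
    then have "eventually (\<lambda>n. cinner (Tl (b n)) (b n) / of_real ((norm (b n))\<^sup>2) + l \<in> closure (num_range D T)) sequentially"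
    proof eventually_elim
      case (elim n)
      have "cinner (Tl (b n)) (b n) / of_real ((norm (b n))\<^sup>2) + l = cinner (T (b n)) (b n) / of_real ((norm (b n))\<^sup>2)"
        using elim by (simp add: Tl_def cinner_shift diff_divide_distrib)
      then show ?case
        using num_range_normalize[OF T lim(3) elim] closure_subset by auto
    qed
    from Lim_in_closed_set[OF closed_closure this _ t] show ?thesis by simp
  qed
  then have "closure (num_range D T) = UNIV" by auto
  \<comment> \<open>A convex set in the plane has the same interior as its closure.\<close>
  then have "interior (num_range D T) = UNIV"
    using convex_interior_closure[OF convex_num_range[OF T]] by simp
  then show ?thesis using interior_subset by blast
qed

text \<open>Against a vector of the adjoint domain, \<open>T\<close> moves to the other side, so
  norm convergence of \<open>y\<close> to zero forces \<open>cinner v w = 0\<close> for every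
  \<open>w\<close> in the intersection; density would then make \<open>v\<close> zero.\<close>

lemma not_dense_of_singular_seq:
  assumes y: "singular_seq D (\<lambda>x. T x - l *\<^sub>C x) y v"
  shows "closure (D \<inter> adj_dom D T) \<noteq> UNIV"
proof
  assume dense: "closure (D \<inter> adj_dom D T) = UNIV"
  have "v \<noteq> 0" using y by (auto simp: singular_seq_def)
  from dense_not_orthogonal[OF dense this] obtain w where w: "w \<in> D" "w \<in> adj_dom D T" "cinner v w \<noteq> 0" by blast
  obtain z where z: "\<And>x. x \<in> D \<Longrightarrow> cinner (T x) w = cinner x z" using w(2) unfolding adj_dom_def by blast
  have yD: "y n \<in> D" and y0: "y \<longlonglongrightarrow> 0" for n using y by (auto simp: singular_seq_def)
  have "(\<lambda>n. cinner (y n) z - l * cinner (y n) w) \<longlonglongrightarrow> cinner 0 z - l * cinner 0 w"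
    by (intro tendsto_intros tendsto_cinner y0)
  moreover have "(\<lambda>n. cinner (T (y n) - l *\<^sub>C y n) w) \<longlonglongrightarrow> cinner v w"
    using y w(1) unfolding singular_seq_def by blast
  then have "(\<lambda>n. cinner (y n) z - l * cinner (y n) w) \<longlonglongrightarrow> cinner v w"
    by (simp add: cinner_simps z[OF yD])
  ultimately show False using w(3) LIMSEQ_unique by fastforce
qed

theorem theorem3p1:
  fixes D :: "'h::chilbert_space set" and T :: "'h \<Rightarrow> 'h"
  assumes separable: "\<exists>S. countable S \<and> closure S = (UNIV :: 'h set)"
    and infinite_dim: "\<not> (\<exists>F. finite F \<and> cspan F = (UNIV :: 'h set))"
    and lin: "clinear_on D T"
  shows "(We1 D T \<subseteq> We4 D T \<and> We4 D T \<subseteq> We2 D T \<and> We2 D T = We3 D T \<and> We3 D T = ess_num_range D T) \<and>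
         (closure D = UNIV \<longrightarrow>
           We1 D T \<subseteq> We4 D T \<and> We4 D T = We2 D T \<and> We2 D T = We3 D T \<and> We3 D T = ess_num_range D T) \<and>
         (closure (D \<inter> adj_dom D T) = UNIV \<or> num_range D T \<noteq> UNIV \<longrightarrow>
           We1 D T = ess_num_range D T \<and> We2 D T = ess_num_range D T \<and>
           We3 D T = ess_num_range D T \<and> We4 D T = ess_num_range D T)"
proof -
  have 14: "We1 D T \<subseteq> We4 D T" by (rule We1_subset_We4)
  \<comment> \<open>The inclusions of \<open>We2\<close> in \<open>ess_num_range\<close>, of that in
    \<open>We3\<close>, and of \<open>We3\<close> in \<open>We2\<close> close a cycle.\<close>
  have 23: "We2 D T = We3 D T" and 3: "We3 D T = ess_num_range D T"
    using ess_num_range_subset_We3[of D T] We3_subset_We2[of D T] We2_subset_ess_num_range[OF separable lin]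
    by auto
  have 42: "We4 D T \<subseteq> We2 D T" unfolding 23 3 by (rule We4_subset_ess_num_range)
  have dense: "We4 D T = We2 D T" if "closure D = UNIV"
    using 42 We2_subset_We4[OF infinite_dim that lin] by blast
  \<comment> \<open>This turns the chain from \<open>We1\<close> through \<open>We4\<close> to
    \<open>We2\<close> into equalities: a violating point would yield a singular sequence, which
    each of the two conditions forbids.\<close>
  have "We2 D T \<subseteq> We1 D T" if "closure (D \<inter> adj_dom D T) = UNIV \<or> num_range D T \<noteq> UNIV"
  proof (rule subsetI, rule ccontr)
    fix l assume l2: "l \<in> We2 D T" and l1: "l \<notin> We1 D T"
    obtain y v where "singular_seq D (\<lambda>x. T x - l *\<^sub>C x) y v"
      using singular_seq_of_notin_We1[OF lin l1 l2] by blast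
    then show False
      using that num_range_UNIV_of_singular_seq[OF lin] not_dense_of_singular_seq by blast
  qed
  then show ?thesis using 14 23 3 42 dense by blast
qed

end
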